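(* Let $H\le F_m$ be a non-cyclic free factor whose Whitehead graph contains a cut vertex, and let $\varphi$ be the Whitehead automorphism, described in the context, for which the ergodic automaton $\mathcal{B}_{\varphi(H)}$ recognizing $L_{\varphi(H)}$ can be obtained from $\mathcal{B}_H$ by collapsing certain edges of $\mathcal{B}_H$. Then $$\alpha_H<\alpha_{\varphi(H)},$$ where $\alpha_H$ and $\alpha_{\varphi(H)}$ are the cogrowths of $H$ and $\varphi(H)$, respectively.
   Context: Free group and words. $F_m$ is the free group of finite rank $m>2$ with fixed basis $X=\{x_1,\dots,x_m\}$, and $\Sigma=X\cup X^{-1}$. A word $y_1\cdots y_n$ over $\Sigma$ is reduced if $y_{i+1}\ne y_i^{-1}$ for all $i$, and cyclically reduced if moreover $y_n\ne y_1^{-1}$. Standing assumption: $H$ is a non-trivial, non-cyclic finitely generated subgroup generated by cyclically reduced words. For a subgroup $K\le F_m$, $L_K$ is the language of reduced words representing elements of $K$. Cogrowth. For a finitely generated $K\le F_m$, $\alpha_K=\limsup_{n\to\infty}\sqrt[n]{a_n}$, where $a_n$ is the number of reduced elements of length $n$ in $K$ with respect to the basis $X$. Core. The Schreier graph of $K$ has the right cosets $Kg$ as vertices and, for each coset and each $x\in X$, an edge labeled $x$ from $Kg$ to $Kgx$; its root is $v_1=K$. The core $\Delta_K$ is the subgraph that is the union of the reduced closed paths based at $v_1$ (edges may be traversed backwards, reading the inverse letter). The extended core $\widehat\Delta_K$ has the same vertices and, for each edge $e$ of $\Delta_K$ labeled $x$, both $e$ and an inverse edge $\bar e$ labeled $x^{-1}$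 from the terminus of $e$ to its origin. $L_v\subseteq\Sigma$ is the set of labels of edges of $\widehat\Delta_K$ with origin $v$; for $z\in L_v$, $vz$ is the terminus of that edge. Automaton $\mathcal{B}_K$. Its states are the pairs $(v,y)$, with $v$ a vertex of $\widehat\Delta_K$ and $y\in\Sigma$, such that some edge of $\widehat\Delta_K$ labeled $y$ terminates at $v$. From $(v,y)$ there is an edge labeled $z$ to $(vz,z)$ for every $z\in L_v$, $z\ne y^{-1}$. Both the initial and the final states are all states $(v_1,y)$. A word is accepted if it labels a path from an initial to a final state. An automaton is ergodic if its transition diagram is strongly connected. Collapsing the edges that terminate at a state $\sigma$ means that every two-edge path $p\to\sigma\to r$, whose second edge is labeled $z$, becomes a single edge $p\to r$ labeled $z$, and $\sigma$ disappears (if $\sigma$ was initial and final, it is replaced in that role by the origins $p$). Whitehead graph. The Whitehead graph of $H$ is the undirected graph with vertex set $\Sigma$ and, for every vertex $v$ of $\Delta_H$ and every pair of distinct letters of $L_v$, an edge between these letters. A vertex $a$ of it is a cut vertex if it is non-isolated and either the connected component of $a$ does not contain $a^{-1}$, or the connected component of $a$ becomes disconnected when $a$ is removed. Whitehead automorphism. For $a\in\Sigma$ and $A\subseteq\Sigma\setminus\{a,a^{-1}\}$, $\varphi=(A,a)$ is the automorphism of $F_m$ with $a\mapsto a$ and, for the other generators, $x_j\mapsto x_j$ if $x_j,x_j^{-1}\notin A$; $x_j\mapsto ax_j$ if $x_j\in A$, $x_j^{-1}\notin A$; $x_j\mapsto x_ja^{-1}$ if $x_j\notin A$, $x_j^{-1}\in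 A$; $x_j\mapsto ax_ja^{-1}$ if $x_j,x_j^{-1}\in A$. The automorphism $\varphi$. If $H$ is a free factor whose Whitehead graph contains a cut vertex, a theorem of Ascari gives a Whitehead automorphism $\varphi=(A,a)$ such that $\Delta_{\varphi(H)}$ has strictly fewer vertices and strictly fewer edges than $\Delta_H$, chosen so that at each vertex $v$ of $\Delta_H$ exactly one of the following holds: $L_v\cap A=\emptyset$; $L_v\subseteq A$; or $a\in L_v$ and $L_v\subseteq A\cup\{a\}$. For $H$ non-cyclic, this is the automorphism for which it is shown that $\mathcal{B}_{\varphi(H)}$ can be obtained from $\mathcal{B}_H$ by collapsing certain edges of $\mathcal{B}_H$. *)

theory Defs
  imports "HOL-Algebra.Algebra" "HOL-Library.Extended_Real" "HOL-Library.Liminf_Limsup"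
    "HOL-Library.Cardinality"
begin

section \<open>The free group as the group of reduced words\<close>

text \<open>The basis is the type \<open>'a\<close>; the letter \<open>(x, True)\<close> stands for the basis element
  \<open>x\<close> and \<open>(x, False)\<close> for its formal inverse, so that the alphabet of all letters
  is \<open>UNIV\<close>.\<close>

type_synonym 'a letter = "'a \<times> bool"
type_synonym 'a word = "'a letter list"

definition letter_inv :: "'a letter \<Rightarrow> 'a letter" where
  "letter_inv y = (fst y, \<not> snd y)"

definition reduced :: "'a word \<Rightarrow> bool" where
  "reduced w \<longleftrightarrow> successively (\<lambda>y z. z \<noteq> letter_inv y) w"

definition cyclically_reduced :: "'a word \<Rightarrow> bool" where
  "cyclically_reduced w \<longleftrightarrow> reduced w \<and> (w \<noteq> [] \<longrightarrow> last w \<noteq> letter_inv (hd w))"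

fun push_letter :: "'a letter \<Rightarrow> 'a word \<Rightarrow> 'a word" where
  "push_letter y [] = [y]"
| "push_letter y (z # w) = (if z = letter_inv y then w else y # z # w)"

definition reduce :: "'a word \<Rightarrow> 'a word" where
  "reduce w = foldr push_letter w []"

definition free_group :: "'a word monoid" where
  "free_group = \<lparr>carrier = {w. reduced w}, monoid.mult = (\<lambda>u v. reduce (u @ v)), one = []\<rparr>"

lemma letter_inv_invol [simp]: "letter_inv (letter_inv y) = y"
  by (simp add: letter_inv_def)

lemma letter_inv_neq [simp]: "letter_inv y \<noteq> y" "y \<noteq> letter_inv y"
  by (auto simp: letter_inv_def prod_eq_iff)

lemma letter_inv_eq_iff [simp]: "letter_inv y = letter_inv z \<longleftrightarrow> y = z"
  by (metis letter_inv_invol)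

lemma reduced_Nil [simp]: "reduced []"
  by (simp add: reduced_def)

lemma reduced_single [simp]: "reduced [y]"
  by (simp add: reduced_def)

lemma reduced_Cons_Cons [simp]:
  "reduced (y # z # w) \<longleftrightarrow> z \<noteq> letter_inv y \<and> reduced (z # w)"
  by (simp add: reduced_def)

lemma reduced_tl: "reduced (y # w) \<Longrightarrow> reduced w"
  by (cases w) auto

lemma reduced_push: "reduced w \<Longrightarrow> reduced (push_letter y w)"
  by (cases w) (auto dest: reduced_tl)

lemma reduced_foldr: "reduced w \<Longrightarrow> reduced (foldr push_letter u w)"
  by (induction u) (auto intro: reduced_push)

lemma reduced_reduce: "reduced (reduce u)"
  unfolding reduce_def by (rule reduced_foldr) simp

lemma push_cancel: "reduced w \<Longrightarrow> push_letter y (push_letter (letter_inv y) w) = w"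
  by (cases w; cases "tl w") auto

lemma foldr_push:
  assumes "reduced w"
  shows "foldr push_letter (push_letter y r) w = push_letter y (foldr push_letter r w)"
proof (cases r)
  case (Cons z s)
  show ?thesis
  proof (cases "z = letter_inv y")
    case True
    then show ?thesis
      using Cons push_cancel[OF reduced_foldr[OF assms]] by simp
  qed (simp add: Cons)
qed simp

lemma foldr_reduce: "reduced w \<Longrightarrow> foldr push_letter (reduce u) w = foldr push_letter u w"
  by (induction u) (simp_all add: reduce_def foldr_push)

lemma reduce_reduced: "reduced w \<Longrightarrow> reduce w = w"
proof (induction w)
  case (Cons y w)
  then show ?case
    by (cases w) (auto simp: reduce_def dest: reduced_tl)
qed (simp add: reduce_def)

lemma reduce_append: "reduced v \<Longrightarrow> reduce (u @ v) = foldr push_letter u v"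
  using reduce_reduced[of v] by (simp add: reduce_def)

lemma carrier_free_group: "carrier free_group = {w. reduced w}"
  and one_free_group: "\<one>\<^bsub>free_group\<^esub> = []"
  and mult_free_group: "u \<otimes>\<^bsub>free_group\<^esub> v = reduce (u @ v)"
  by (simp_all add: free_group_def)

lemma left_inverse_word:
  "reduced w \<Longrightarrow> foldr push_letter (map letter_inv (rev u)) (foldr push_letter u w) = w"
proof (induction u arbitrary: w)
  case (Cons y u)
  have "push_letter (letter_inv y) (push_letter y (foldr push_letter u w)) = foldr push_letter u w"
    using push_cancel[OF reduced_foldr[OF Cons.prems], of "letter_inv y" u] by simp
  then show ?case
    using Cons by simp
qed simp

lemma group_free_group: "group free_group"
proof (rule groupI)
  fix u v w :: "'a word"
  assume "u \<in> carrier free_group" "v \<in> carrier free_group" "w \<in> carrier free_group"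
  then have r: "reduced u" "reduced v" "reduced w"
    by (simp_all add: carrier_free_group)
  show "u \<otimes>\<^bsub>free_group\<^esub> v \<otimes>\<^bsub>free_group\<^esub> w = u \<otimes>\<^bsub>free_group\<^esub> (v \<otimes>\<^bsub>free_group\<^esub> w)"
    using r foldr_reduce[OF r(3), of "u @ v"]
    by (simp add: mult_free_group reduce_append reduced_foldr)
next
  fix u :: "'a word"
  assume "u \<in> carrier free_group"
  then have u: "reduced u"
    by (simp add: carrier_free_group)
  let ?v = "reduce (map letter_inv (rev u))"
  have "reduce (?v @ u) = []"
    using u foldr_reduce[OF u, of "map letter_inv (rev u)"] left_inverse_word[of "[]" u]
      reduce_reduced[OF u]
    by (simp add: reduce_append) (simp add: reduce_def)
  then show "\<exists>v\<in>carrier free_group. v \<otimes>\<^bsub>free_group\<^esub> u = \<one>\<^bsub>free_group\<^esub>"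
    using reduced_reduce by (auto simp: carrier_free_group mult_free_group one_free_group)
qed (auto simp: carrier_free_group mult_free_group one_free_group reduced_reduce reduce_reduced)

section \<open>Free factors\<close>

text \<open>The value in \<open>G\<close> of a word over the symbols \<open>x\<close>, each interpreted as \<open>f x\<close>.\<close>

definition word_eval :: "('g, 'm) monoid_scheme \<Rightarrow> ('x \<Rightarrow> 'g) \<Rightarrow> 'x word \<Rightarrow> 'g" where
  "word_eval G f w =
     foldr (\<lambda>y r. (if snd y then f (fst y) else inv\<^bsub>G\<^esub> (f (fst y))) \<otimes>\<^bsub>G\<^esub> r) w \<one>\<^bsub>G\<^esub>"

context group
begin

abbreviation letter_val :: "('x \<Rightarrow> 'a) \<Rightarrow> 'x letter \<Rightarrow> 'a" where
  "letter_val f y \<equiv> (if snd y then f (fst y) else inv (f (fst y)))"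

lemma word_eval_Nil [simp]: "word_eval G f [] = \<one>"
  and word_eval_Cons [simp]: "word_eval G f (y # w) = letter_val f y \<otimes> word_eval G f w"
  by (simp_all add: word_eval_def)

lemma word_eval_closed [simp]: "range f \<subseteq> carrier G \<Longrightarrow> word_eval G f w \<in> carrier G"
  by (induction w) (auto simp: image_subset_iff)

lemma word_eval_append:
  "range f \<subseteq> carrier G \<Longrightarrow> word_eval G f (u @ v) = word_eval G f u \<otimes> word_eval G f v"
  by (induction u) (auto simp: image_subset_iff m_assoc)

lemma word_eval_push:
  assumes "range f \<subseteq> carrier G"
  shows "word_eval G f (push_letter y w) = letter_val f y \<otimes> word_eval G f w"
proof (cases w)
  case (Cons z s)
  have c: "f x \<in> carrier G" for x
    using assms by auto
  show ?thesis
    using assms by (auto simp: Cons letter_inv_def c inv_solve_left m_assoc[symmetric])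
qed simp

lemma word_eval_reduce:
  "range f \<subseteq> carrier G \<Longrightarrow> word_eval G f (reduce w) = word_eval G f w"
  by (induction w) (simp_all add: reduce_def word_eval_push)

lemma word_eval_hom: "range f \<subseteq> carrier G \<Longrightarrow> word_eval G f \<in> hom free_group G"
  by (auto simp: hom_def mult_free_group word_eval_reduce word_eval_append)

lemma hom_word_eval:
  assumes "h \<in> hom G K" "group K" "range f \<subseteq> carrier G"
  shows "h (word_eval G f w) = word_eval K (h \<circ> f) w"
proof -
  interpret K: group K by fact
  interpret group_hom G K h
    using assms by (simp add: group_hom_def group_hom_axioms_def is_group)
  have c: "f x \<in> carrier G" for x
    using assms by auto
  show ?thesis
    by (induction w) (auto simp: c assms(3))
qed

end

definition free_basis :: "('g, 'm) monoid_scheme \<Rightarrow> 'g set \<Rightarrow> bool" where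
  "free_basis G B \<longleftrightarrow> B \<subseteq> carrier G \<and> generate G B = carrier G \<and>
     (\<forall>w. reduced w \<and> w \<noteq> [] \<and> fst ` set w \<subseteq> B \<longrightarrow> word_eval G (\<lambda>g. g) w \<noteq> \<one>\<^bsub>G\<^esub>)"

definition free_factor :: "('g, 'm) monoid_scheme \<Rightarrow> 'g set \<Rightarrow> bool" where
  "free_factor G H \<longleftrightarrow> (\<exists>B S. free_basis G B \<and> S \<subseteq> B \<and> H = generate G S)"

definition finitely_generated :: "('g, 'm) monoid_scheme \<Rightarrow> 'g set \<Rightarrow> bool" where
  "finitely_generated G H \<longleftrightarrow> (\<exists>S. finite S \<and> S \<subseteq> carrier G \<and> H = generate G S)"

section \<open>Cogrowth\<close>

definition cogrowth :: "'a word set \<Rightarrow> ereal" where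
  "cogrowth K = limsup (\<lambda>n. ereal (root n (real (card {w \<in> K. length w = n}))))"

section \<open>Schreier graph and core\<close>

text \<open>Vertices of the Schreier graph are right cosets. Its edge labelled by the basis element
  \<open>x\<close> that leaves the coset \<open>v\<close> is the triple \<open>(v, x, v')\<close>, with \<open>v'\<close> the terminus.\<close>

type_synonym 'a coset = "'a word set"
type_synonym 'a edge = "'a coset \<times> 'a \<times> 'a coset"

definition coset_step :: "'a coset \<Rightarrow> 'a letter \<Rightarrow> 'a coset" where
  "coset_step v y = v #>\<^bsub>free_group\<^esub> [y]"

definition path_end :: "'a coset \<Rightarrow> 'a word \<Rightarrow> 'a coset" where
  "path_end v w = foldl coset_step v w"

text \<open>An edge traversed backwards reads the inverse letter.\<close>

definition traversed_edge :: "'a coset \<Rightarrow> 'a letter \<Rightarrow> 'a edge" where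
  "traversed_edge v y =
     (if snd y then (v, fst y, coset_step v y) else (coset_step v y, fst y, v))"

text \<open>A path in the Schreier graph is determined by its origin and its label, and it is a
  reduced path exactly when its label is a reduced word.\<close>

definition reduced_closed_paths :: "'a word set \<Rightarrow> 'a word set" where
  "reduced_closed_paths K = {w. reduced w \<and> path_end K w = K}"

definition core_verts :: "'a word set \<Rightarrow> 'a coset set" where
  "core_verts K = {path_end K (take i w) | i w. w \<in> reduced_closed_paths K \<and> i \<le> length w}"

definition core_edges :: "'a word set \<Rightarrow> 'a edge set" where
  "core_edges K =
     {traversed_edge (path_end K (take i w)) (w ! i) | i w.
        w \<in> reduced_closed_paths K \<and> i < length w}"

definition extended_core_edges :: "'a word set \<Rightarrow> ('a coset \<times> 'a letter \<times> 'a coset) set" where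
  "extended_core_edges K =
     {(v, (x, True), v') | v x v'. (v, x, v') \<in> core_edges K} \<union>
     {(v', (x, False), v) | v x v'. (v, x, v') \<in> core_edges K}"

definition out_labels :: "'a word set \<Rightarrow> 'a coset \<Rightarrow> 'a letter set" where
  "out_labels K v = {z. \<exists>v'. (v, z, v') \<in> extended_core_edges K}"

section \<open>Whitehead graph\<close>

definition whitehead_graph :: "'a word set \<Rightarrow> ('a letter \<times> 'a letter) set" where
  "whitehead_graph H =
     {(y, z). y \<noteq> z \<and> (\<exists>v \<in> core_verts H. y \<in> out_labels H v \<and> z \<in> out_labels H v)}"

text \<open>An undirected graph on the letters is given by its symmetric adjacency relation \<open>E\<close>.\<close>

definition component :: "('v \<times> 'v) set \<Rightarrow> 'v \<Rightarrow> 'v set" where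
  "component E a = {b. (a, b) \<in> E\<^sup>*}"

definition connected_on :: "('v \<times> 'v) set \<Rightarrow> 'v set \<Rightarrow> bool" where
  "connected_on E C \<longleftrightarrow> (\<forall>b \<in> C. \<forall>c \<in> C. (b, c) \<in> (E \<inter> C \<times> C)\<^sup>*)"

definition cut_vertex :: "('a letter \<times> 'a letter) set \<Rightarrow> 'a letter \<Rightarrow> bool" where
  "cut_vertex E a \<longleftrightarrow> (\<exists>b. (a, b) \<in> E) \<and>
     (letter_inv a \<notin> component E a \<or> \<not> connected_on E (component E a - {a}))"

section \<open>Whitehead automorphisms\<close>

definition whitehead_gen :: "'a letter set \<Rightarrow> 'a letter \<Rightarrow> 'a \<Rightarrow> 'a word" where
  "whitehead_gen A a x =
    (if x = fst a then [(x, True)]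
     else if (x, True) \<notin> A \<and> (x, False) \<notin> A then [(x, True)]
     else if (x, True) \<in> A \<and> (x, False) \<notin> A then [a, (x, True)]
     else if (x, True) \<notin> A \<and> (x, False) \<in> A then [(x, True), letter_inv a]
     else [a, (x, True), letter_inv a])"

definition whitehead_aut :: "'a letter set \<Rightarrow> 'a letter \<Rightarrow> 'a word \<Rightarrow> 'a word" where
  "whitehead_aut A a = word_eval free_group (whitehead_gen A a)"

lemma inv_letter: "inv\<^bsub>free_group\<^esub> [y] = [letter_inv y]"
  by (rule group.inv_equality[OF group_free_group])
    (simp_all add: carrier_free_group mult_free_group one_free_group reduce_def)

lemma word_eval_singletons:
  "reduced w \<Longrightarrow> word_eval free_group (\<lambda>x. [(x, True)]) w = w"
proof (induction w)
  case Nil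
  then show ?case
    by (simp add: group.word_eval_Nil[OF group_free_group] one_free_group)
next
  case (Cons y w)
  then have "word_eval free_group (\<lambda>x. [(x, True)]) w = w"
    by (auto dest: reduced_tl)
  then show ?case
    using reduce_reduced[OF Cons.prems]
    by (cases y) (auto simp: group.word_eval_Cons[OF group_free_group] mult_free_group inv_letter
        letter_inv_def)
qed

lemma whitehead_gen_closed: "range (whitehead_gen A a) \<subseteq> carrier free_group"
  by (cases a) (auto simp: whitehead_gen_def carrier_free_group letter_inv_def)

lemma whitehead_aut_hom: "whitehead_aut A a \<in> hom free_group free_group"
  unfolding whitehead_aut_def
  by (rule group.word_eval_hom[OF group_free_group whitehead_gen_closed])

lemma whitehead_aut_inverse:
  assumes "w \<in> carrier free_group" "A \<subseteq> UNIV - {a, letter_inv a}"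
  shows "whitehead_aut A (letter_inv a) (whitehead_aut A a w) = w"
proof -
  let ?h = "whitehead_aut A (letter_inv a)"
  have "?h (whitehead_gen A a x) = [(x, True)]" for x
    unfolding whitehead_aut_def
    by (cases a; cases "snd a")
      (auto simp: whitehead_gen_def group.word_eval_Cons[OF group_free_group]
        group.word_eval_Nil[OF group_free_group] letter_inv_def inv_letter mult_free_group
        one_free_group reduce_def)
  then have "?h \<circ> whitehead_gen A a = (\<lambda>x. [(x, True)])"
    by auto
  then show ?thesis
    using group.hom_word_eval[OF group_free_group whitehead_aut_hom group_free_group
        whitehead_gen_closed, of A "letter_inv a" A a w] assms
    by (simp add: whitehead_aut_def word_eval_singletons carrier_free_group)
qed

lemma whitehead_aut_iso:
  assumes "A \<subseteq> UNIV - {a, letter_inv a}"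
  shows "whitehead_aut A a \<in> iso free_group free_group"
proof -
  have c: "whitehead_aut A b ` carrier free_group \<subseteq> carrier free_group" for b
    by (rule image_subsetI) (rule hom_in_carrier[OF whitehead_aut_hom])
  have "A \<subseteq> UNIV - {letter_inv a, letter_inv (letter_inv a)}"
    using assms by auto
  then have "bij_betw (whitehead_aut A a) (carrier free_group) (carrier free_group)"
    using assms whitehead_aut_inverse[of _ A a] whitehead_aut_inverse[of _ A "letter_inv a"]
    by (intro bij_betw_byWitness[where f' = "whitehead_aut A (letter_inv a)"] c) auto
  then show ?thesis
    using whitehead_aut_hom by (simp add: iso_def)
qed

text \<open>The conditions describing the automorphism \<open>(A, a)\<close> provided by Ascari's theorem for
  \<open>H\<close>. The cores of finitely generated subgroups are finite, so that the cardinalities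
  are the true numbers of vertices and edges.\<close>

definition exactly_one :: "bool \<Rightarrow> bool \<Rightarrow> bool \<Rightarrow> bool" where
  "exactly_one P Q R \<longleftrightarrow> (P \<and> \<not> Q \<and> \<not> R) \<or> (\<not> P \<and> Q \<and> \<not> R) \<or> (\<not> P \<and> \<not> Q \<and> R)"

definition ascari_pair :: "'a word set \<Rightarrow> 'a letter set \<Rightarrow> 'a letter \<Rightarrow> bool" where
  "ascari_pair H A a \<longleftrightarrow>
     A \<subseteq> UNIV - {a, letter_inv a} \<and>
     card (core_verts (whitehead_aut A a ` H)) < card (core_verts H) \<and>
     card (core_edges (whitehead_aut A a ` H)) < card (core_edges H) \<and>
     (\<forall>v \<in> core_verts H.
        exactly_one (out_labels H v \<inter> A = {})
                    (out_labels H v \<subseteq> A)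
                    (a \<in> out_labels H v \<and> out_labels H v \<subseteq> A \<union> {a}))"

end

theory Submission
  imports Defs
begin

text \<open>A reduced word of \<open>H\<close> is read along a closed path of the core, and by the condition on the
  labels \<open>\<phi>\<close> acts on it, up to conjugation by \<open>a\<close>, by deleting the letters read along certain
  edges labelled \<open>a\<close>. At least one edge is deleted, since the core becomes smaller. Let \<open>\<alpha>\<close>
  be the cogrowth of \<open>H\<close> and \<open>U\<close> the monoid of the labels of closed paths that end by traversing
  such an edge. Submultiplicativity gives at least \<open>\<alpha>\<^sup>n\<close> factors of length \<open>n\<close> of words of
  \<open>H\<close>, and since \<open>H\<close> is not cyclic each of them can be extended by a bounded number of letters to
  an element of \<open>U\<close>. So the generating function of \<open>U\<close> diverges at \<open>t = 1 / \<alpha>\<close>, that is, the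
  generating function of its free basis is at least 1 there. As \<open>\<phi>\<close> shortens every basis word by at
  least one letter and \<open>t < 1\<close>, the shortened basis words have generating function greater than 1 at
  some \<open>s < t\<close>, hence \<open>\<phi>(H)\<close> has cogrowth at least \<open>1 / s > \<alpha>\<close>.\<close>

section \<open>Reduced words and paths in the Schreier graph\<close>

definition word_inv :: "'a word \<Rightarrow> 'a word" where
  "word_inv w = map letter_inv (rev w)"

lemma word_inv_Nil [simp]: "word_inv [] = []"
  and word_inv_Cons [simp]: "word_inv (y # w) = word_inv w @ [letter_inv y]"
  and word_inv_append [simp]: "word_inv (u @ v) = word_inv v @ word_inv u"
  and word_inv_invol [simp]: "word_inv (word_inv w) = w"
  and length_word_inv [simp]: "length (word_inv w) = length w"
  and word_inv_eq_Nil [simp]: "word_inv w = [] \<longleftrightarrow> w = []"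
  by (simp_all add: word_inv_def rev_map comp_def)

lemma hd_word_inv: "w \<noteq> [] \<Longrightarrow> hd (word_inv w) = letter_inv (last w)"
  and last_word_inv: "w \<noteq> [] \<Longrightarrow> last (word_inv w) = letter_inv (hd w)"
  by (simp_all add: word_inv_def hd_map last_map hd_rev last_rev)

lemma letter_inv_eq_swap: "letter_inv y = z \<longleftrightarrow> y = letter_inv z"
  by auto

lemma reduced_append:
  "reduced (u @ v) \<longleftrightarrow>
     reduced u \<and> reduced v \<and> (u \<noteq> [] \<longrightarrow> v \<noteq> [] \<longrightarrow> hd v \<noteq> letter_inv (last u))"
  by (auto simp: reduced_def successively_append_iff)

lemma reduced_Cons:
  "reduced (y # v) \<longleftrightarrow> reduced v \<and> (v \<noteq> [] \<longrightarrow> hd v \<noteq> letter_inv y)"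
  using reduced_append[of "[y]" v] by simp

lemma reduced_word_inv [simp]: "reduced (word_inv w) \<longleftrightarrow> reduced w"
proof -
  have *: "reduced w \<Longrightarrow> reduced (word_inv w)" for w :: "'a word"
    by (induction w) (auto simp: reduced_Cons reduced_append last_word_inv)
  show ?thesis
    using *[of w] *[of "word_inv w"] by auto
qed

text \<open>Letter \<open>i\<close> of such a word would be inverse to letter
  \<open>n - 1 - i\<close>. In odd length the middle letter would be its own inverse; in even length
  the two middle letters would cancel.\<close>

lemma word_inv_ne_self:
  assumes "reduced w" "w \<noteq> []"
  shows "word_inv w \<noteq> w"
proof
  assume eq: "word_inv w = w"
  define n where "n = length w"
  have nth: "w ! i = letter_inv (w ! (n - 1 - i))" if "i < n" for i
  proof -
    have "w ! i = word_inv w ! i"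
      by (simp add: eq)
    also have "\<dots> = letter_inv (w ! (n - 1 - i))"
      using that by (simp add: word_inv_def rev_nth n_def)
    finally show ?thesis .
  qed
  have n: "n > 0"
    using assms by (simp add: n_def)
  show False
  proof (cases "even n")
    case True
    then obtain k where k: "n = 2 * Suc k"
      using n by (metis evenE gr0_implies_Suc mult_is_0 neq0_conv)
    have "w = take (Suc k) w @ drop (Suc k) w"
      by simp
    then have "hd (drop (Suc k) w) \<noteq> letter_inv (last (take (Suc k) w))"
      using assms k n_def reduced_append[of "take (Suc k) w" "drop (Suc k) w"] by auto
    moreover have "hd (drop (Suc k) w) = w ! Suc k"
      using k n_def by (simp add: hd_drop_conv_nth)
    moreover have "last (take (Suc k) w) = w ! k"
      using k n_def by (simp add: take_Suc_conv_app_nth)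
    ultimately show False
      using nth[of "Suc k"] k by simp
  next
    case False
    then obtain k where "n = 2 * k + 1"
      by (elim oddE)
    then show False
      using nth[of k] by simp
  qed
qed

text \<open>Comparing lengths, either \<open>u\<close> begins with \<open>word_inv w\<close> and
  ends with \<open>w\<close>, which gives a shorter solution, or \<open>w\<close> splits into two
  words that are their own inverses. It separates the two loops of
  \<open>obtain_two_loops\<close>.\<close>

lemma word_inv_conj_ne:
  assumes "reduced w" "w \<noteq> []"
  shows "word_inv w @ u \<noteq> u @ w"
proof (induction u rule: length_induct)
  case (1 u)
  show ?case
  proof
    assume eq: "word_inv w @ u = u @ w"
    then consider x where "u = word_inv w @ x" "u = x @ w"
      | x where "word_inv w = u @ x" "w = x @ u"
      unfolding append_eq_append_conv2[of "word_inv w" u u w] by metis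
    then show False
    proof cases
      case (1 x)
      then have "length x < length u" "word_inv w @ x = x @ w"
        using assms by simp_all
      then show False
        using "1.IH" by blast
    next
      case (2 x)
      then have "word_inv u @ word_inv x = u @ x"
        using word_inv_append[of x u] by simp
      then have "word_inv u = u" "word_inv x = x"
        by simp_all
      moreover have "reduced u" "reduced x"
        using assms(1) 2(2) by (simp_all add: reduced_append)
      ultimately have "u = []" "x = []"
        using word_inv_ne_self by blast+
      then show False
        using assms(2) 2(2) by simp
    qed
  qed
qed

section \<open>Cancellation in products of reduced words\<close>

lemma length_push_le: "length (push_letter y w) \<le> Suc (length w)"
  by (cases w) auto

lemma length_reduce_le: "length (reduce w) \<le> length w"
  by (induction w) (auto simp: reduce_def intro: order_trans[OF length_push_le])

lemma reduce_cancel: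
  assumes "reduced v"
  shows "reduce (u @ [y] @ [letter_inv y] @ v) = reduce (u @ v)"
proof -
  have "push_letter y (push_letter (letter_inv y) (foldr push_letter v [])) = foldr push_letter v []"
    using push_cancel[OF reduced_foldr[of "[]" v]] by simp
  then show ?thesis
    by (simp add: reduce_def)
qed

text \<open>Cancellation takes place only where the two words meet: the last letter of
  \<open>u\<close> is stripped as long as it faces its inverse, and the stripped letters form the
  block \<open>c\<close>.\<close>

lemma reduce_append_cancel:
  assumes "reduced u" "reduced v"
  obtains u' c v' where "u = u' @ c" "v = word_inv c @ v'" "reduce (u @ v) = u' @ v'"
    "reduced (u' @ v')"
  using assms
proof (induction u arbitrary: v thesis rule: rev_induct)
  case Nil
  then show ?case
    using reduce_reduced[OF Nil(3)] by simp
next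
  case (snoc y u)
  show ?case
  proof (cases "reduced ((u @ [y]) @ v)")
    case True
    then show ?thesis
      using snoc.prems(1)[of "u @ [y]" "[]" v] reduce_reduced[OF True] by simp
  next
    case False
    then have "v \<noteq> []" "hd v = letter_inv y"
      using snoc.prems(2,3) reduced_append[of "u @ [y]" v] by auto
    then obtain v1 where v: "v = letter_inv y # v1"
      by (cases v) auto
    have r: "reduced u" "reduced v1"
      using snoc.prems v by (auto simp: reduced_append reduced_Cons)
    obtain u' c v' where *: "u = u' @ c" "v1 = word_inv c @ v'" "reduce (u @ v1) = u' @ v'"
      "reduced (u' @ v')"
      using snoc.IH[OF _ r] by blast
    show ?thesis
      using snoc.prems(1)[of u' "c @ [y]" v'] * v reduce_cancel[OF r(2), of u y] by simp
  qed
qed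

section \<open>Paths in the Schreier graph and right cosets\<close>

lemma path_end_append: "path_end v (u @ w) = path_end (path_end v u) w"
  and path_end_Nil [simp]: "path_end v [] = v"
  and path_end_Cons: "path_end v (y # w) = path_end (coset_step v y) w"
  by (simp_all add: path_end_def)

lemma coset_step_closed:
  "v \<subseteq> carrier free_group \<Longrightarrow> coset_step v y \<subseteq> carrier free_group"
  unfolding coset_step_def
  by (rule monoid.r_coset_subset_G[OF group.is_monoid[OF group_free_group]])
    (simp_all add: carrier_free_group)

lemma path_end_closed:
  "v \<subseteq> carrier free_group \<Longrightarrow> path_end v w \<subseteq> carrier free_group"
  by (induction w arbitrary: v) (simp_all add: path_end_Cons coset_step_closed)

lemma coset_step_inverse:
  assumes "v \<subseteq> carrier free_group"
  shows "coset_step (coset_step v y) (letter_inv y) = v"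
proof -
  interpret F: group "free_group :: 'a word monoid"
    by (rule group_free_group)
  have "[y] \<otimes>\<^bsub>free_group\<^esub> [letter_inv y] = \<one>\<^bsub>free_group\<^esub>"
    by (simp add: mult_free_group one_free_group reduce_def)
  then show ?thesis
    using assms by (simp add: coset_step_def F.coset_mult_assoc carrier_free_group F.coset_mult_one)
qed

lemma path_end_word_inv:
  assumes "v \<subseteq> carrier free_group"
  shows "path_end (path_end v w) (word_inv w) = v"
  using assms
  by (induction w arbitrary: v)
    (simp_all add: path_end_Cons path_end_append coset_step_closed coset_step_inverse)

lemma mult_reduced: "reduced (u @ v) \<Longrightarrow> u \<otimes>\<^bsub>free_group\<^esub> v = u @ v"
  by (simp add: mult_free_group reduce_reduced)

lemma path_end_coset:
  assumes "v \<subseteq> carrier free_group" "reduced w"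
  shows "path_end v w = v #>\<^bsub>free_group\<^esub> w"
  using assms(2)
proof (induction w rule: rev_induct)
  case Nil
  then show ?case
    using group.coset_mult_one[OF group_free_group assms(1)] by (simp add: one_free_group)
next
  case (snoc y w)
  interpret F: group "free_group :: 'a word monoid"
    by (rule group_free_group)
  have "path_end v (w @ [y]) = (v #>\<^bsub>free_group\<^esub> w) #>\<^bsub>free_group\<^esub> [y]"
    using snoc by (simp add: path_end_append path_end_Cons coset_step_def reduced_append)
  also have "\<dots> = v #>\<^bsub>free_group\<^esub> (w @ [y])"
    using snoc.prems assms(1)
    by (subst F.coset_mult_assoc) (auto simp: carrier_free_group reduced_append mult_reduced)
  finally show ?case .
qed

section \<open>Elements of a subgroup as closed paths, and the labels at core vertices\<close>

locale free_subgroup =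
  fixes H :: "'a word set"
  assumes subgroup: "subgroup H free_group"
begin

lemma closed: "H \<subseteq> carrier free_group"
  using subgroup by (rule subgroup.subset)

lemma mem_iff: "w \<in> H \<longleftrightarrow> reduced w \<and> path_end H w = H"
proof -
  have "reduced w" if "w \<in> H"
    using that closed by (auto simp: carrier_free_group)
  then show ?thesis
    using group.coset_join1[OF group_free_group _ _ subgroup, of w]
      group.coset_join2[OF group_free_group _ subgroup, of w] path_end_coset[OF closed, of w]
    by (auto simp: carrier_free_group)
qed

lemma mem_reduced: "w \<in> H \<Longrightarrow> reduced w"
  by (simp add: mem_iff)

lemma reduced_closed_paths_eq: "reduced_closed_paths H = H"
  unfolding reduced_closed_paths_def using mem_iff by blast

lemma Nil_mem: "[] \<in> H"
  by (simp add: mem_iff)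

lemma append_mem:
  "u \<in> H \<Longrightarrow> v \<in> H \<Longrightarrow> (u \<noteq> [] \<Longrightarrow> v \<noteq> [] \<Longrightarrow> hd v \<noteq> letter_inv (last u)) \<Longrightarrow> u @ v \<in> H"
  by (simp add: mem_iff path_end_append reduced_append)

lemma word_inv_mem: "w \<in> H \<Longrightarrow> word_inv w \<in> H"
  using path_end_word_inv[OF closed, of w] by (simp add: mem_iff)

lemma reduce_append_mem: "u \<in> H \<Longrightarrow> v \<in> H \<Longrightarrow> reduce (u @ v) \<in> H"
  using subgroup.m_closed[OF subgroup, of u v] by (simp add: mult_free_group)

text \<open>The path \<open>u @ v\<close> closes up at the root, so reading \<open>v\<close>
  backwards from the root retraces it to the end of \<open>u\<close>. Hence members of
  \<open>H\<close> with a common tail are at the same vertex where that tail starts.\<close>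

lemma path_end_rev:
  assumes "u @ v \<in> H"
  shows "path_end H (word_inv v) = path_end H u"
proof -
  have "path_end (path_end (path_end H u) v) (word_inv v) = path_end H u"
    by (rule path_end_word_inv[OF path_end_closed[OF closed]])
  then show ?thesis
    using assms by (simp add: mem_iff path_end_append)
qed

lemma core_vertsI: "u @ v \<in> H \<Longrightarrow> path_end H u \<in> core_verts H"
  unfolding core_verts_def reduced_closed_paths_eq
  by (intro CollectI exI[of _ "length u"] exI[of _ "u @ v"]) simp

lemma core_edgesI:
  assumes "u @ [y] @ v \<in> H"
  shows "traversed_edge (path_end H u) y \<in> core_edges H"
  unfolding core_edges_def reduced_closed_paths_eq using assms
  by (intro CollectI exI[of _ "length u"] exI[of _ "u @ [y] @ v"]) simp

lemma out_labelsI: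
  assumes "u @ [y] @ v \<in> H"
  shows "y \<in> out_labels H (path_end H u)"
  using core_edgesI[OF assms]
  by (cases y; cases "snd y")
    (auto simp: out_labels_def extended_core_edges_def traversed_edge_def)

lemma out_labels_inverseI:
  assumes "u @ [y] @ v \<in> H"
  shows "letter_inv y \<in> out_labels H (path_end H (u @ [y]))"
proof -
  have "word_inv v @ [letter_inv y] @ word_inv u \<in> H"
    using word_inv_mem[OF assms] by simp
  then show ?thesis
    using out_labelsI path_end_rev[of "u @ [y]" v] assms by fastforce
qed

text \<open>Converse of the two preceding facts: a closed path crosses the underlying core edge
  either in the wanted direction, or against it, and then its inverse is taken.\<close>

lemma out_labelsE:
  assumes "z \<in> out_labels H v"
  obtains p q where "p @ [z] @ q \<in> H" "path_end H p = v"
proof -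
  obtain v' where "(v, z, v') \<in> extended_core_edges H"
    using assms by (auto simp: out_labels_def)
  then have "if snd z then (v, fst z, v') \<in> core_edges H else (v', fst z, v) \<in> core_edges H"
    by (auto simp: extended_core_edges_def)
  then obtain i w where w: "w \<in> H" "i < length w"
    and edge: "traversed_edge (path_end H (take i w)) (w ! i) =
      (if snd z then (v, fst z, v') else (v', fst z, v))"
    unfolding core_edges_def reduced_closed_paths_eq
    by (auto split: if_splits)
  define p y q where "p = take i w" and "y = w ! i" and "q = drop (Suc i) w"
  have pq: "p @ [y] @ q \<in> H"
    using w by (simp add: p_def y_def q_def id_take_nth_drop[symmetric])
  have "(z = y \<and> path_end H p = v) \<or> (z = letter_inv y \<and> path_end H (p @ [y]) = v)"
    using edge by (cases z; cases y)
      (auto simp: traversed_edge_def letter_inv_def p_def[symmetric] y_def[symmetric]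
        path_end_append path_end_Cons split: if_splits)
  then show thesis
  proof
    assume "z = y \<and> path_end H p = v"
    then show thesis
      using that pq by simp
  next
    assume z: "z = letter_inv y \<and> path_end H (p @ [y]) = v"
    have "word_inv q @ [letter_inv y] @ word_inv p \<in> H"
      using word_inv_mem[OF pq] by simp
    moreover have "path_end H (word_inv q) = v"
      using path_end_rev[of "p @ [y]" q] pq z by simp
    ultimately show thesis
      using that z by simp
  qed
qed

end

section \<open>Growth of languages\<close>

lemma finite_words_length: "finite {w \<in> K. length (w :: 'b :: finite list) = n}"
  by (rule finite_subset[OF _ finite_lists_length_eq[OF finite[of UNIV], of n]]) auto

lemma finite_words_length_le: "finite {w \<in> K. length (w :: 'b :: finite list) \<le> n}"
  by (rule finite_subset[OF _ finite_lists_length_le[OF finite[of UNIV], of n]]) auto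

lemma cogrowth_le:
  fixes K :: "('a :: finite) word set"
  assumes "C > 0" "\<gamma> \<ge> 0" and le: "\<And>n. real (card {w \<in> K. length w = n}) \<le> C * \<gamma> ^ n"
  shows "cogrowth K \<le> ereal \<gamma>"
proof -
  have "root n (real (card {w \<in> K. length w = n})) \<le> root n C * \<gamma>" if "n > 0" for n
    using that le[of n] assms by (metis real_root_le_iff real_root_mult real_root_power_cancel)
  then have "cogrowth K \<le> limsup (\<lambda>n. ereal (root n C * \<gamma>))"
    unfolding cogrowth_def
    by (intro Limsup_mono eventually_sequentiallyI[of 1]) simp
  also have "(\<lambda>n. ereal (root n C * \<gamma>)) \<longlonglongrightarrow> ereal (1 * \<gamma>)"
    using assms by (intro tendsto_intros LIMSEQ_root_const)
  then have "limsup (\<lambda>n. ereal (root n C * \<gamma>)) = ereal \<gamma>"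
    by (simp add: lim_imp_Limsup)
  finally show ?thesis .
qed

lemma cogrowth_finite: "cogrowth (K :: ('a :: finite) word set) < \<infinity>"
proof -
  define c where "c = CARD('a letter)"
  have "card {w \<in> K. length w = n} \<le> c ^ n" for n
    using card_mono[of "{w. set w \<subseteq> UNIV \<and> length w = n}" "{w \<in> K. length w = n}"]
      card_lists_length_eq[of "UNIV :: 'a letter set" n]
      finite_lists_length_eq[of "UNIV :: 'a letter set" n]
    by (auto simp: c_def)
  then have "cogrowth K \<le> ereal (real c)"
    by (intro cogrowth_le[of 1]) (simp_all flip: of_nat_power)
  then show ?thesis
    by (rule le_less_trans) simp
qed

text \<open>Distributivity: expanding the \<open>k\<close>-th power yields one product for each list
  of length \<open>k\<close>.\<close>

lemma sum_lists_length:
  fixes g :: "'b \<Rightarrow> real"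
  assumes "finite F"
  shows "(\<Sum>xs | set xs \<subseteq> F \<and> length xs = k. prod_list (map g xs)) = sum g F ^ k"
proof (induction k)
  case (Suc k)
  have eq: "{xs. set xs \<subseteq> F \<and> length xs = Suc k} =
      (\<lambda>(x, xs). x # xs) ` (F \<times> {xs. set xs \<subseteq> F \<and> length xs = k})"
    by (auto simp: length_Suc_conv image_iff)
  have "(\<Sum>xs | set xs \<subseteq> F \<and> length xs = Suc k. prod_list (map g xs)) =
      (\<Sum>(x, xs) \<in> F \<times> {xs. set xs \<subseteq> F \<and> length xs = k}. g x * prod_list (map g xs))"
    unfolding eq by (subst sum.reindex) (auto simp: inj_on_def case_prod_unfold)
  also have "\<dots> = sum g F * sum g F ^ k"
    by (simp add: sum_product Suc[symmetric] flip: sum.cartesian_product)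
  finally show ?case
    by simp
next
  case 0
  have "{xs. set xs \<subseteq> F \<and> length xs = 0} = {[]}"
    by auto
  then show ?case
    by simp
qed

lemma prod_list_power: "prod_list (map (\<lambda>x. (s :: real) ^ wt x) xs) = s ^ sum_list (map wt xs)"
  by (induction xs) (simp_all add: power_add)

text \<open>If the cogrowth were below \<open>1 / s\<close>, the series of
  \<open>s ^ length w\<close> over \<open>K\<close> would converge. But the lists of
  \<open>k\<close> elements of \<open>F\<close> contribute at least
  \<open>s ^ c * \<rho> ^ k\<close>, where \<open>\<rho> > 1\<close> is the sum over
  \<open>F\<close>, and this is unbounded in \<open>k\<close>. Each \<open>k\<close> is treated on
  its own, so injectivity of \<open>f\<close> is asked only for lists of equal length.\<close>

lemma cogrowth_ge_of_code:
  fixes K :: "('a :: finite) word set" and f :: "'b list \<Rightarrow> 'a word"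
  assumes F: "finite F" and s: "0 < s" "s < 1" and big: "1 < (\<Sum>x\<in>F. s ^ wt x)"
    and inj: "\<And>k. inj_on f {xs. set xs \<subseteq> F \<and> length xs = k}"
    and mem: "\<And>xs. set xs \<subseteq> F \<Longrightarrow> f xs \<in> K"
    and len: "\<And>xs. set xs \<subseteq> F \<Longrightarrow> length (f xs) \<le> c + sum_list (map wt xs)"
  shows "ereal (1 / s) \<le> cogrowth K"
proof (rule ccontr)
  define a where "a n = card {w \<in> K. length w = n}" for n
  assume "\<not> ereal (1 / s) \<le> cogrowth K"
  then obtain x where x: "cogrowth K < ereal x" "x < 1 / s"
    by (metis ereal_dense2 ereal_less(2) less_ereal.simps(1) linorder_not_le)
  have "eventually (\<lambda>n. ereal (root n (real (a n))) < ereal x) sequentially"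
    using Limsup_lessD[OF x(1)[unfolded cogrowth_def]] by (simp add: a_def)
  then obtain N where N: "root n (real (a n)) < x" if "n \<ge> N" for n
    by (auto simp: eventually_sequentially)
  have "0 \<le> root (Suc N) (real (a (Suc N)))"
    by (rule real_root_ge_zero) simp_all
  then have x0: "0 < x"
    using N[of "Suc N"] by linarith
  \<comment> \<open>\<open>Suc N\<close> keeps the index positive: \<open>root 0\<close> is
    constantly 0 and says nothing about \<open>a 0\<close>.\<close>
  have "a n \<le> x ^ n" if "n \<ge> Suc N" for n
  proof -
    have "real (a n) = root n (real (a n)) ^ n"
      using that by (simp add: real_root_pow_pos2)
    also have "\<dots> \<le> x ^ n"
      using N[of n] that by (intro power_mono) auto
    finally show ?thesis .
  qed
  then have "norm (a n * s ^ n) \<le> (x * s) ^ n" if "n \<ge> Suc N" for n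
    using that s by (simp add: power_mult_distrib mult_right_mono)
  moreover have "summable (\<lambda>n. (x * s) ^ n)"
    using x x0 s by (intro summable_geometric) (simp add: field_simps)
  ultimately have summable: "summable (\<lambda>n. a n * s ^ n)"
    by (rule summable_comparison_test'[rotated])
  define C where "C = suminf (\<lambda>n. a n * s ^ n)"
  have finite_sum: "(\<Sum>w\<in>W. s ^ length w) \<le> C" if "finite W" "W \<subseteq> K" for W
  proof -
    have "(\<Sum>w\<in>W. s ^ length w) = (\<Sum>n\<in>length ` W. \<Sum>w\<in>{w \<in> W. length w = n}. s ^ length w)"
      using that by (intro sum.image_gen)
    also have "\<dots> \<le> (\<Sum>n\<in>length ` W. a n * s ^ n)"
    proof (rule sum_mono)
      fix n
      have "card {w \<in> W. length w = n} \<le> a n"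
        unfolding a_def using that by (intro card_mono finite_words_length) auto
      then show "(\<Sum>w\<in>{w \<in> W. length w = n}. s ^ length w) \<le> a n * s ^ n"
        using s by (simp add: mult_right_mono)
    qed
    also have "\<dots> \<le> C"
      unfolding C_def using that s by (intro sum_le_suminf summable) auto
    finally show ?thesis .
  qed
  define \<rho> where "\<rho> = (\<Sum>x\<in>F. s ^ wt x)"
  have "s ^ c * \<rho> ^ k \<le> C" for k
  proof -
    let ?L = "{xs. set xs \<subseteq> F \<and> length xs = k}"
    have "s ^ c * \<rho> ^ k = (\<Sum>xs\<in>?L. s ^ (c + sum_list (map wt xs)))"
      unfolding \<rho>_def sum_lists_length[OF F, symmetric]
      by (simp add: prod_list_power power_add sum_distrib_left)
    also have "\<dots> \<le> (\<Sum>xs\<in>?L. s ^ length (f xs))"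
      using s len by (intro sum_mono power_decreasing) auto
    also have "\<dots> = (\<Sum>w\<in>f ` ?L. s ^ length w)"
      by (simp add: sum.reindex[OF inj])
    also have "\<dots> \<le> C"
      using mem by (intro finite_sum finite_imageI finite_lists_length_eq F) auto
    finally show ?thesis .
  qed
  moreover obtain k where "C / s ^ c < \<rho> ^ k"
    using real_arch_pow[of \<rho>] big by (auto simp: \<rho>_def)
  moreover have "0 < s ^ c"
    using s by simp
  ultimately show False
    by (metis divide_less_eq linorder_not_le mult.commute)
qed

text \<open>The first factor can be read off from the concatenation. Since both lists have length
  \<open>k\<close>, the induction removes one factor from each side at a time.\<close>

lemma concat_inj_prefix_code:
  assumes "\<And>x y u v. x \<in> F \<Longrightarrow> y \<in> F \<Longrightarrow> x @ u = y @ v \<Longrightarrow> x = y"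
  shows "inj_on concat {xs. set xs \<subseteq> F \<and> length xs = k}"
proof -
  have "xs = ys" if "concat xs = concat ys" "set xs \<subseteq> F" "set ys \<subseteq> F" "length xs = length ys"
    for xs ys
    using that(4,1-3)
    by (induction xs ys rule: list_induct2) (auto dest: assms)
  then show ?thesis
    by (auto simp: inj_on_def)
qed

text \<open>The number of words of length \<open>n\<close> in a factorial language is submultiplicative in \<open>n\<close>.\<close>

lemma factorial_language_growth:
  fixes K L :: "('a :: finite) word set"
  assumes factorial: "\<And>u v. u @ v \<in> L \<Longrightarrow> u \<in> L \<and> v \<in> L" and "K \<subseteq> L"
    and \<alpha>: "cogrowth K = ereal \<alpha>" "\<alpha> > 1"
  shows "\<alpha> ^ n \<le> real (card {w \<in> L. length w = n})"
proof (rule ccontr)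
  define T where "T n = card {w \<in> L. length w = n}" for n
  assume "\<not> ?thesis"
  then have less: "real (T n) < \<alpha> ^ n"
    by (simp add: T_def)
  have submult: "T (m + k) \<le> T m * T k" for m k
  proof -
    have "inj_on (\<lambda>w. (take m w, drop m w)) {w \<in> L. length w = m + k}"
      by (rule inj_onI) (metis append_take_drop_id prod.inject)
    moreover have "(\<lambda>w. (take m w, drop m w)) ` {w \<in> L. length w = m + k} \<subseteq>
        {w \<in> L. length w = m} \<times> {w \<in> L. length w = k}"
    proof (rule image_subsetI)
      fix w assume w: "w \<in> {w \<in> L. length w = m + k}"
      then have "take m w \<in> L" "drop m w \<in> L"
        using factorial[of "take m w" "drop m w"] by auto
      then show "(take m w, drop m w) \<in> {w \<in> L. length w = m} \<times> {w \<in> L. length w = k}"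
        using w by simp
    qed
    ultimately have "T (m + k) \<le> card ({w \<in> L. length w = m} \<times> {w \<in> L. length w = k})"
      unfolding T_def
      by (intro card_inj_on_le[of "\<lambda>w. (take m w, drop m w)"] finite_cartesian_product
          finite_words_length) auto
    then show ?thesis
      by (simp add: T_def card_cartesian_product)
  qed
  have power: "T (n * q + r) \<le> T n ^ q * T r" for q r
  proof (induction q)
    case (Suc q)
    have "T (n * Suc q + r) \<le> T n * T (n * q + r)"
      using submult[of n "n * q + r"] by (simp add: add.assoc)
    also have "\<dots> \<le> T n * (T n ^ q * T r)"
      using Suc by (rule mult_left_mono) simp
    finally show ?case
      by (simp add: mult.assoc)
  qed simp
  \<comment> \<open>Writing \<open>m = n * q + r\<close> with \<open>r < n\<close>,
    submultiplicativity will give \<open>T m \<le> C * \<gamma> ^ m\<close> with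
    \<open>\<gamma> < \<alpha>\<close>. The maximum with 1 makes powers of \<open>\<gamma>\<close>
    increase with the exponent, \<open>C\<close> bounds every remainder term, and its summand 1
    keeps it positive.\<close>
  define \<gamma> where "\<gamma> = max 1 (root n (real (T n)))"
  define C where "C = 1 + (\<Sum>r<n. real (T r))"
  have C: "C > 0"
    by (simp add: C_def add_pos_nonneg sum_nonneg)
  \<comment> \<open>For \<open>n = 0\<close> the assumption says that not even the empty word is in
    \<open>L\<close>; then \<open>L\<close> is empty and the cogrowth of \<open>K\<close> is at most
    0.\<close>
  have n: "n > 0"
  proof (rule ccontr)
    assume "\<not> n > 0"
    then have "T 0 = 0" "n = 0"
      using less by auto
    then have "T m = 0" for m
      using submult[of 0 m] by simp
    then have "real (card {w \<in> K. length w = m}) \<le> 1 * 0 ^ m" for m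
      using card_mono[OF finite_words_length, of "{w \<in> K. length w = m}" L m] \<open>K \<subseteq> L\<close>
      by (force simp: T_def)
    then have "cogrowth K \<le> ereal 0"
      by (intro cogrowth_le[of 1]) auto
    then show False
      using \<alpha> by simp
  qed
  have \<gamma>: "1 \<le> \<gamma>" "real (T n) \<le> \<gamma> ^ n" "\<gamma> < \<alpha>"
  proof -
    have "real (T n) = root n (real (T n)) ^ n"
      using n by simp
    also have "\<dots> \<le> \<gamma> ^ n"
      using n by (intro power_mono) (auto simp: \<gamma>_def)
    finally show "real (T n) \<le> \<gamma> ^ n" .
    have "root n (real (T n)) < root n (\<alpha> ^ n)"
      using less n by simp
    then show "\<gamma> < \<alpha>"
      using n \<alpha> by (simp add: \<gamma>_def real_root_power_cancel)
  qed (simp add: \<gamma>_def)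
  have "real (card {w \<in> K. length w = m}) \<le> C * \<gamma> ^ m" for m
  proof -
    have "card {w \<in> K. length w = m} \<le> T m"
      unfolding T_def using \<open>K \<subseteq> L\<close> by (intro card_mono finite_words_length) auto
    also have "\<dots> \<le> T n ^ (m div n) * T (m mod n)"
      using power[of "m div n" "m mod n"] by simp
    finally have "real (card {w \<in> K. length w = m}) \<le> real (T n) ^ (m div n) * real (T (m mod n))"
      by (simp flip: of_nat_power of_nat_mult)
    also have "\<dots> \<le> (\<gamma> ^ n) ^ (m div n) * C"
    proof (rule mult_mono)
      have "real (T (m mod n)) \<le> (\<Sum>r<n. real (T r))"
        using n by (intro member_le_sum) auto
      then show "real (T (m mod n)) \<le> C"
        by (simp add: C_def)
    qed (use \<gamma> in \<open>auto intro: power_mono\<close>)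
    also have "\<dots> \<le> \<gamma> ^ m * C"
      unfolding power_mult[symmetric] using \<gamma> C
      by (intro mult_right_mono power_increasing) auto
    finally show ?thesis
      by (simp add: mult.commute)
  qed
  then have "cogrowth K \<le> ereal \<gamma>"
    using \<gamma> C by (intro cogrowth_le) auto
  then show False
    using \<alpha> \<gamma> by simp
qed

section \<open>Irreducible words of a language and their generating function\<close>

definition irreducibles :: "'b list set \<Rightarrow> 'b list set" where
  "irreducibles U =
    {r \<in> U. r \<noteq> [] \<and> \<not> (\<exists>x \<in> U. \<exists>y \<in> U. x \<noteq> [] \<and> y \<noteq> [] \<and> r = x @ y)}"

text \<open>If one irreducible word properly extended another, unitarity would put the remainder
  into \<open>U\<close>, and the longer word would factor.\<close>

lemma irreducibles_prefix_code:
  assumes unitary: "\<forall>u\<in>U. \<forall>v. u @ v \<in> U \<longrightarrow> v \<in> U"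
    and "x \<in> irreducibles U" "y \<in> irreducibles U" "x @ u = y @ v"
  shows "x = y"
proof -
  have *: "z = []" if "x \<in> irreducibles U" "x @ z \<in> irreducibles U" for x z
  proof (rule ccontr)
    assume "z \<noteq> []"
    have "x \<in> U" "x @ z \<in> U" "x \<noteq> []"
      using that by (simp_all add: irreducibles_def)
    moreover have "z \<in> U"
      using unitary calculation by blast
    ultimately show False
      using that(2) \<open>z \<noteq> []\<close> unfolding irreducibles_def by blast
  qed
  from \<open>x @ u = y @ v\<close> obtain z where "x = y @ z \<or> y = x @ z"
    unfolding append_eq_append_conv2 by blast
  then show ?thesis
    using *[of y z] *[of x z] assms(2,3) by auto
qed

text \<open>A reducible word starts with a shorter nonempty word of \<open>U\<close>, to which
  induction applies; what follows the irreducible prefix lies in \<open>U\<close> by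
  unitarity.\<close>

lemma irreducible_prefix:
  assumes unitary: "\<forall>u\<in>U. \<forall>v. u @ v \<in> U \<longrightarrow> v \<in> U" and "u \<in> U" "u \<noteq> []"
  obtains r v where "r \<in> irreducibles U" "v \<in> U" "u = r @ v"
  using assms(2,3)
proof (induction u arbitrary: thesis rule: length_induct)
  case (1 u)
  show ?case
  proof (cases "u \<in> irreducibles U")
    case True
    \<comment> \<open>Unitarity applied to \<open>u = u @ []\<close> gives
      \<open>[] \<in> U\<close>, so the remainder may be empty.\<close>
    then show ?thesis
      using "1.prems"(1)[of u "[]"] unitary[rule_format, of u "[]"] "1.prems"(2) True by simp
  next
    case False
    then obtain x y where xy: "x \<in> U" "y \<in> U" "x \<noteq> []" "y \<noteq> []" "u = x @ y"
      using "1.prems"(2,3) unfolding irreducibles_def by blast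
    have "length x < length u"
      using xy by simp
    then obtain r v where rv: "r \<in> irreducibles U" "v \<in> U" "x = r @ v"
      using "1.IH" xy(1,3) by blast
    have "r \<in> U"
      using rv by (simp add: irreducibles_def)
    then have "v @ y \<in> U"
      using unitary[rule_format, of r "v @ y"] "1.prems"(2) xy(5) rv(3) by simp
    then show ?thesis
      using "1.prems"(1) rv(1,3) xy(5) by simp
  qed
qed

text \<open>The generating function \<open>S\<close> of \<open>U\<close> and that \<open>R\<close> of the irreducible words satisfy
  \<open>S \<le> 1 + R S\<close>, so that divergence of \<open>S(t)\<close> forces \<open>R(t) \<ge> 1\<close>. Shortening every irreducible
  word by one letter multiplies \<open>R(t)\<close> by \<open>1 / t\<close>.\<close>

lemma irreducibles_shortened_sum:
  fixes U :: "'b :: finite list set" and t :: real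
  assumes unitary: "\<forall>u\<in>U. \<forall>v. u @ v \<in> U \<longrightarrow> v \<in> U"
    and t: "0 < t" "t < 1"
    and unbounded: "\<And>B. \<exists>N. B < (\<Sum>u | u \<in> U \<and> length u \<le> N. t ^ length u)"
  obtains F s where "finite F" "F \<subseteq> irreducibles U" "0 < s" "s < t"
    "1 < (\<Sum>r\<in>F. s ^ (length r - 1))"
proof -
  define R where "R N = {r \<in> irreducibles U. length r \<le> N}" for N
  define S where "S N = (\<Sum>u | u \<in> U \<and> length u \<le> N. t ^ length u)" for N
  have S_nonneg: "0 \<le> S N" for N
    unfolding S_def using t by (intro sum_nonneg) simp
  have finite_R: "finite (R N)" for N
    unfolding R_def by (rule finite_words_length_le)
  have recurrence: "S N \<le> 1 + (\<Sum>r\<in>R N. t ^ length r) * S N" for N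
  proof -
    let ?U = "{u \<in> U. length u \<le> N}"
    have "?U \<subseteq> insert [] ((\<lambda>(r, u). r @ u) ` (R N \<times> ?U))"
    proof
      fix u assume u: "u \<in> ?U"
      show "u \<in> insert [] ((\<lambda>(r, u). r @ u) ` (R N \<times> ?U))"
      proof (cases "u = []")
        case False
        then obtain r v where "r \<in> irreducibles U" "v \<in> U" "u = r @ v"
          using u irreducible_prefix[OF unitary, of u] by blast
        then show ?thesis
          using u by (force simp: R_def)
      qed simp
    qed
    then have "S N \<le> (\<Sum>u\<in>insert [] ((\<lambda>(r, u). r @ u) ` (R N \<times> ?U)). t ^ length u)"
      unfolding S_def using t finite_R finite_words_length_le
      by (intro sum_mono2 finite.insertI finite_imageI finite_cartesian_product) auto
    also have "\<dots> \<le> 1 + (\<Sum>u\<in>(\<lambda>(r, u). r @ u) ` (R N \<times> ?U). t ^ length u)"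
      using t finite_R finite_words_length_le[of U N] by (subst sum.insert_if) auto
    also have "\<dots> \<le> 1 + (\<Sum>(r, u)\<in>R N \<times> ?U. t ^ length (r @ u))"
      using t finite_R finite_words_length_le[of U N]
        sum_image_le[of "R N \<times> ?U" "\<lambda>u. t ^ length u" "\<lambda>(r, u). r @ u"]
      by (auto simp: case_prod_unfold comp_def)
    also have "\<dots> = 1 + (\<Sum>r\<in>R N. t ^ length r) * S N"
      by (simp add: S_def sum_product power_add flip: sum.cartesian_product)
    finally show ?thesis .
  qed
  \<comment> \<open>If the irreducible words up to length \<open>N\<close> had sum at most
    \<open>t\<close>, the recurrence would force \<open>S N \<le> 1 / (1 - t)\<close>. A sum above
    \<open>t\<close> suffices, because one letter less in each word divides the sum by
    \<open>t\<close>.\<close>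
  obtain N where N: "1 / (1 - t) < S N"
    using unbounded unfolding S_def by blast
  have "t < (\<Sum>r\<in>R N. t ^ length r)"
  proof (rule ccontr)
    assume "\<not> ?thesis"
    then have "(\<Sum>r\<in>R N. t ^ length r) * S N \<le> t * S N"
      by (intro mult_right_mono S_nonneg) simp
    then have "S N \<le> 1 + t * S N"
      using recurrence[of N] by linarith
    then show False
      using N t by (simp add: field_simps)
  qed
  also have "(\<Sum>r\<in>R N. t ^ length r) = t * (\<Sum>r\<in>R N. t ^ (length r - 1))"
    unfolding sum_distrib_left
  proof (rule sum.cong[OF refl])
    fix r assume "r \<in> R N"
    then have "length r = Suc (length r - 1)"
      by (simp add: R_def irreducibles_def)
    then show "t ^ length r = t * t ^ (length r - 1)"
      by (metis power_Suc)
  qed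
  finally have "1 < (\<Sum>r\<in>R N. t ^ (length r - 1))"
    using t by simp
  \<comment> \<open>The sum is a polynomial in \<open>s\<close>, so by continuity the strict
    inequality at \<open>t\<close> persists slightly to the left of \<open>t\<close>.\<close>
  moreover have "((\<lambda>s. \<Sum>r\<in>R N. s ^ (length r - 1)) \<longlongrightarrow> (\<Sum>r\<in>R N. t ^ (length r - 1))) (at_left t)"
    by (intro tendsto_intros)
  ultimately have "\<forall>\<^sub>F s in at_left t. 1 < (\<Sum>r\<in>R N. s ^ (length r - 1))"
    by (simp add: order_tendstoD)
  moreover have "\<forall>\<^sub>F s in at_left t. s \<in> {0<..<t}"
    using t by (intro eventually_at_leftI) auto
  ultimately have "\<forall>\<^sub>F s in at_left t. s \<in> {0<..<t} \<and> 1 < (\<Sum>r\<in>R N. s ^ (length r - 1))"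
    by (rule eventually_conj[rotated])
  then obtain s where "s \<in> {0<..<t}" "1 < (\<Sum>r\<in>R N. s ^ (length r - 1))"
    using eventually_happens'[OF trivial_limit_at_left_real] by blast
  then show thesis
    using that[of "R N" s] finite_R by (auto simp: R_def)
qed

text \<open>Extending the words of length \<open>n\<close> gives words of \<open>U\<close> with
  lengths from \<open>n\<close> to \<open>n + 2 * R\<close>, and few words share an extension. Each
  such window of lengths therefore contributes at least a fixed amount to the sum, and there are
  infinitely many disjoint windows.\<close>

lemma unbounded_sum_of_extensions:
  fixes L U :: "'b :: finite list set" and \<alpha> :: real
  assumes \<alpha>: "1 < \<alpha>" and growth: "\<And>n. \<alpha> ^ n \<le> real (card {w \<in> L. length w = n})"
    and ext: "\<And>w. w \<in> L \<Longrightarrow> w \<noteq> [] \<Longrightarrow> \<exists>x y. length x \<le> R \<and> length y \<le> R \<and> x @ w @ y \<in> U"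
  shows "\<exists>N. B < (\<Sum>u | u \<in> U \<and> length u \<le> N. (1 / \<alpha>) ^ length u)"
proof -
  define t where "t = 1 / \<alpha>"
  have t: "0 < t" "t < 1"
    using \<alpha> by (simp_all add: t_def)
  define S where "S N = (\<Sum>u | u \<in> U \<and> length u \<le> N. t ^ length u)" for N
  \<comment> \<open>The power pays for at most \<open>2 * R\<close> added letters, the denominator
    for the \<open>Suc R\<close> possible lengths of the left extension.\<close>
  define \<delta> where "\<delta> = t ^ (2 * R) / real (Suc R)"
  have "0 < \<delta>"
    using t by (simp add: \<delta>_def)
  obtain l r where lr: "length (l w) \<le> R" "length (r w) \<le> R" "l w @ w @ r w \<in> U"
    if "w \<in> L" "w \<noteq> []" for w
    using ext by metis
  define W where "W n = {u \<in> U. n \<le> length u \<and> length u \<le> n + 2 * R}" for n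
  have finite_W: "finite (W n)" for n
    using finite_words_length_le[of U "n + 2 * R"] by (rule finite_subset[rotated]) (auto simp: W_def)
  have block: "\<delta> \<le> (\<Sum>u\<in>W n. t ^ length u)" if "n > 0" for n
  proof -
    \<comment> \<open>The first component records where \<open>w\<close> starts inside its
      extension, which makes \<open>w\<close> recoverable.\<close>
    let ?f = "\<lambda>w. (length (l w), l w @ w @ r w)"
    have "inj_on ?f {w \<in> L. length w = n}"
    proof (rule inj_onI)
      fix w w' assume w: "w \<in> {w \<in> L. length w = n}" "w' \<in> {w \<in> L. length w = n}" "?f w = ?f w'"
      have "w = take n (drop (length (l w)) (l w @ w @ r w))"
        using w(1) by simp
      also have "\<dots> = take n (drop (length (l w')) (l w' @ w' @ r w'))"
        using w(3) by simp
      also have "\<dots> = w'"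
        using w(2) by simp
      finally show "w = w'" .
    qed
    moreover have "?f ` {w \<in> L. length w = n} \<subseteq> {..R} \<times> W n"
    proof (rule image_subsetI)
      fix w assume "w \<in> {w \<in> L. length w = n}"
      then show "?f w \<in> {..R} \<times> W n"
        using lr[of w] that by (auto simp: W_def)
    qed
    ultimately have "card {w \<in> L. length w = n} \<le> card ({..R} \<times> W n)"
      using finite_W by (intro card_inj_on_le finite_cartesian_product) auto
    then have "card {w \<in> L. length w = n} \<le> Suc R * card (W n)"
      by (simp add: card_cartesian_product)
    then have "real (card {w \<in> L. length w = n}) \<le> real (Suc R * card (W n))"
      by (rule of_nat_mono)
    then have "\<alpha> ^ n \<le> real (Suc R * card (W n))"
      using growth[of n] by linarith
    then have "1 \<le> t ^ n * (real (Suc R) * real (card (W n)))"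
      using \<alpha> by (simp add: t_def power_one_over field_simps)
    then have "t ^ (2 * R) * 1 \<le> t ^ (2 * R) * (t ^ n * (real (Suc R) * real (card (W n))))"
      using t by (intro mult_left_mono) auto
    then have "\<delta> \<le> card (W n) * t ^ (n + 2 * R)"
      by (simp add: \<delta>_def power_add field_simps del: of_nat_Suc)
    also have "\<dots> = (\<Sum>u\<in>W n. t ^ (n + 2 * R))"
      by simp
    also have "\<dots> \<le> (\<Sum>u\<in>W n. t ^ length u)"
      using t by (intro sum_mono power_decreasing) (auto simp: W_def)
    finally show ?thesis .
  qed
  \<comment> \<open>A window covers \<open>Suc (2 * R)\<close> lengths; the one starting at
    \<open>Suc N\<close> adjoins the words of length at most \<open>N\<close> without
    overlap.\<close>
  have "real k * \<delta> \<le> S (k * Suc (2 * R))" for k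
  proof (induction k)
    case 0
    then show ?case
      using t by (auto simp: S_def intro!: sum_nonneg)
  next
    case (Suc k)
    define N where "N = k * Suc (2 * R)"
    have "real (Suc k) * \<delta> = real k * \<delta> + \<delta>"
      by (simp add: distrib_right)
    also have "\<dots> \<le> S N + (\<Sum>u\<in>W (Suc N). t ^ length u)"
      using Suc block[of "Suc N"] unfolding N_def by (intro add_mono) auto
    also have "\<dots> = (\<Sum>u\<in>{u. u \<in> U \<and> length u \<le> N} \<union> W (Suc N). t ^ length u)"
      unfolding S_def
      by (intro sum.union_disjoint[symmetric] finite_W finite_words_length_le) (auto simp: W_def)
    also have "\<dots> \<le> S (Suc N + 2 * R)"
      unfolding S_def using t
      by (intro sum_mono2 finite_words_length_le) (auto simp: W_def)
    also have "Suc N + 2 * R = Suc k * Suc (2 * R)"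
      by (simp add: N_def)
    finally show ?case .
  qed
  moreover obtain k where "B < real k * \<delta>"
    using reals_Archimedean3[OF \<open>0 < \<delta>\<close>] by blast
  ultimately have "B < S (k * Suc (2 * R))"
    by (meson less_le_trans)
  then show ?thesis
    unfolding S_def t_def by blast
qed

section \<open>Ergodicity\<close>

context free_subgroup
begin

lemma concat_mem:
  assumes F: "\<And>x. x \<in> F \<Longrightarrow> x \<in> H \<and> x \<noteq> [] \<and> hd x = y \<and> last x = z"
    and yz: "y \<noteq> letter_inv z"
    and "set xs \<subseteq> F"
  shows "concat xs \<in> H"
proof -
  have "concat xs \<in> H \<and> (concat xs \<noteq> [] \<longrightarrow> hd (concat xs) = y)"
    using assms(3)
  proof (induction xs)
    case (Cons x xs)
    then have x: "x \<in> H" "x \<noteq> []" "hd x = y" "last x = z"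
      using F by auto
    have "concat xs \<in> H" "concat xs \<noteq> [] \<longrightarrow> hd (concat xs) = y"
      using Cons by auto
    then show ?case
      using x yz by (auto intro: append_mem)
  qed (simp add: Nil_mem)
  then show ?thesis ..
qed

lemma cyclicI:
  assumes "s \<in> H" "H \<subseteq> generate free_group {s}"
  shows "cyclic_group (subgroup_generated free_group H)"
proof -
  interpret F: group "free_group :: 'a word monoid"
    by (rule group_free_group)
  have "generate free_group {s} \<subseteq> H"
    using assms subgroup by (intro F.generate_subgroup_incl) auto
  moreover have "generate free_group H = H"
    using F.generateI[OF subgroup] by blast
  ultimately have "subgroup_generated free_group H = subgroup_generated free_group {s}"
    using assms closed Int_absorb1[OF closed] Int_absorb1[of "{s}" "carrier free_group"]
    by (auto simp: subgroup_generated_def)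
  then show ?thesis
    using F.cyclic_group_generated[of s] by simp
qed

end

locale noncyclic_subgroup = free_subgroup H for H :: "('a :: finite) word set" +
  assumes cyc_red: "\<exists>S. (\<forall>w\<in>S. cyclically_reduced w) \<and> H = generate free_group S"
    and noncyclic: "\<not> cyclic_group (subgroup_generated free_group H)"
begin

text \<open>Were all the cyclically reduced generators empty, \<open>H\<close> would be trivial,
  hence cyclic.\<close>

lemma obtain_cyclically_reduced:
  obtains s where "s \<in> H" "s \<noteq> []" "last s \<noteq> letter_inv (hd s)"
proof -
  interpret F: group "free_group :: 'a word monoid"
    by (rule group_free_group)
  obtain S where S: "\<forall>w\<in>S. cyclically_reduced w" "H = generate free_group S"
    using cyc_red by blast
  have "\<exists>s\<in>S. s \<noteq> []"
  proof (rule ccontr)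
    assume "\<not> (\<exists>s\<in>S. s \<noteq> [])"
    then have "S \<subseteq> {\<one>\<^bsub>free_group\<^esub>}"
      by (auto simp: one_free_group)
    then have "H \<subseteq> {\<one>\<^bsub>free_group\<^esub>}"
      unfolding S(2) by (rule F.generate_subgroup_incl[OF _ F.triv_subgroup])
    then have "H \<subseteq> generate free_group {[]}"
      by (auto simp: one_free_group intro: generate.incl)
    then show False
      using cyclicI[OF Nil_mem] noncyclic by blast
  qed
  then show thesis
    using that S by (auto simp: cyclically_reduced_def intro: generate.incl)
qed

text \<open>If every element of \<open>H\<close> that does not start with \<open>b\<close> ended with the inverse of
  \<open>b\<close>, then the quotient of two such elements could not have a reduced form that keeps parts of
  both, so that the shortest of them would be a suffix of all others and would generate
  \<open>H\<close>.\<close>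

lemma obtain_return:
  obtains h where "h \<in> H" "h \<noteq> []" "hd h \<noteq> b" "last h \<noteq> letter_inv b"
proof -
  interpret F: group "free_group :: 'a word monoid"
    by (rule group_free_group)
  define P where "P = {h \<in> H. h \<noteq> [] \<and> hd h \<noteq> b}"
  have "\<exists>h\<in>H. h \<noteq> [] \<and> hd h \<noteq> b \<and> last h \<noteq> letter_inv b"
  proof (rule ccontr)
    assume "\<not> ?thesis"
    then have last: "last h = letter_inv b" if "h \<in> P" for h
      using that by (auto simp: P_def)
    obtain s0 where s0: "s0 \<in> H" "s0 \<noteq> []" "last s0 \<noteq> letter_inv (hd s0)"
      by (rule obtain_cyclically_reduced)
    \<comment> \<open>If \<open>s0\<close> and its inverse both started with \<open>b\<close>, the
      last letter of \<open>s0\<close> would be inverse to its first.\<close>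
    have "s0 \<in> P \<or> word_inv s0 \<in> P"
      using s0 word_inv_mem[OF s0(1)] by (auto simp: P_def hd_word_inv letter_inv_eq_swap)
    then have "\<exists>s. s \<in> P"
      by blast
    then obtain s where s: "s \<in> P" "\<And>h. h \<in> P \<Longrightarrow> length s \<le> length h"
      using ex_has_least_nat[of "\<lambda>s. s \<in> P" _ length] by blast
    then have s': "s \<in> H" "s \<noteq> []" "hd s \<noteq> b" "reduced s" "last s = letter_inv b"
      using last by (auto simp: P_def mem_iff)
    let ?C = "generate free_group {s}"
    have C: "subgroup ?C free_group"
      using s' by (intro F.generate_is_subgroup) (auto simp: carrier_free_group)
    have sC: "s \<in> ?C"
      by (simp add: generate.incl)
    have PC: "h \<in> ?C" if "h \<in> P" for h
      using that
    proof (induction h rule: length_induct)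
      case (1 h)
      then have h: "h \<in> H" "h \<noteq> []" "hd h \<noteq> b" "reduced h"
        by (auto simp: P_def mem_iff)
      \<comment> \<open>Here \<open>c\<close> is the common suffix of \<open>s\<close> and
        \<open>h\<close> that cancels in \<open>s\<close> times the inverse of \<open>h\<close>. If
        \<open>s1\<close> is empty, \<open>s\<close> is a suffix of \<open>h\<close> and induction
        handles the rest. If only \<open>v\<close> is empty, \<open>h\<close> is shorter than the
        minimal \<open>s\<close>. If both remain, the product is in \<open>P\<close> and ends with
        the inverse of \<open>b\<close>, so \<open>h\<close> would start with
        \<open>b\<close>.\<close>
      obtain s1 c v where eq: "s = s1 @ c" "word_inv h = word_inv c @ v"
        "reduce (s @ word_inv h) = s1 @ v" "reduced (s1 @ v)"
        by (rule reduce_append_cancel[OF s'(4) iffD2[OF reduced_word_inv h(4)]])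
      have g: "s1 @ v \<in> H"
        using reduce_append_mem[OF s'(1) word_inv_mem[OF h(1)]] eq by simp
      have h_eq: "h = word_inv v @ c"
        using arg_cong[OF eq(2), of word_inv] by simp
      show ?case
      proof (cases "s1 = []")
        case True
        then have hs: "h = word_inv v @ s"
          using h_eq eq by simp
        show ?thesis
        proof (cases "v = []")
          case False
          then have "word_inv v \<in> P"
            using g True h hs word_inv_mem[of v] by (simp add: P_def)
          moreover have "length (word_inv v) < length h"
            using hs s' by simp
          ultimately have "word_inv v \<in> ?C"
            using 1 by blast
          then have "word_inv v \<otimes>\<^bsub>free_group\<^esub> s \<in> ?C"
            using sC by (rule subgroup.m_closed[OF C])
          then show ?thesis
            using mult_reduced[of "word_inv v" s] hs h by simp
        qed (use hs sC in simp)
      next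
        case False
        show ?thesis
        proof (cases "v = []")
          case True
          then show ?thesis
            using h_eq eq False s(2)[OF 1(2)] by simp
        next
          case v: False
          have "hd s1 = hd s"
            using eq False by simp
          then have "s1 @ v \<in> P"
            using g False s' by (simp add: P_def)
          then have "last v = letter_inv b"
            using last v by fastforce
          moreover have "hd h = letter_inv (last v)"
            using h_eq v by (simp add: hd_word_inv)
          ultimately show ?thesis
            using h by simp
        qed
      qed
    qed
    have "h \<in> ?C" if "h \<in> H" for h
    proof -
      have powers: "concat (replicate k s) \<in> H" for k
        using s' by (intro concat_mem[of "{s}" "hd s" "last s"]) auto
      have powersC: "concat (replicate k s) \<in> ?C" for k
      proof (induction k)
        case 0
        then show ?case
          using subgroup.one_closed[OF C] by (simp add: one_free_group)
      next
        case (Suc k)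
        have "reduced (s @ concat (replicate k s))"
          using powers[of "Suc k"] by (simp add: mem_iff)
        then show ?case
          using subgroup.m_closed[OF C sC Suc] by (simp add: mult_reduced)
      qed
      have h: "reduced h"
        using that mem_iff by blast
      \<comment> \<open>This power of \<open>s\<close> is too long to be cancelled completely by
        \<open>h\<close>, so \<open>w\<close> times \<open>h\<close> still starts like
        \<open>s\<close> and lies in \<open>P\<close>. Thus both \<open>w\<close> and the product
        are in \<open>?C\<close>, and so is \<open>h\<close>.\<close>
      define w where "w = concat (replicate (Suc (length h)) s)"
      have len: "length w = Suc (length h) * length s"
        by (simp add: w_def length_concat sum_list_replicate)
      have "length s \<ge> 1"
        using s' by (cases s) auto
      then have "length w > length h"
        using mult_le_mono2[of 1 "length s" "Suc (length h)"] unfolding len mult_1_right by linarith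
      have w: "w \<in> H" "w \<in> ?C" "reduced w"
        using powers[of "Suc (length h)"] powersC[of "Suc (length h)"] unfolding w_def
        by (auto simp: mem_iff)
      have hd: "hd w = hd s"
        using s' by (simp add: w_def)
      obtain u c v where eq: "w = u @ c" "h = word_inv c @ v" "reduce (w @ h) = u @ v"
        "reduced (u @ v)"
        by (rule reduce_append_cancel[OF w(3) h])
      have "u \<noteq> []"
        using eq \<open>length w > length h\<close> by auto
      then have "u @ v \<in> P"
        using reduce_append_mem[OF w(1) that] eq hd s' by (auto simp: P_def)
      then have "w \<otimes>\<^bsub>free_group\<^esub> h \<in> ?C"
        using PC eq by (simp add: mult_free_group)
      then have "inv\<^bsub>free_group\<^esub> w \<otimes>\<^bsub>free_group\<^esub> (w \<otimes>\<^bsub>free_group\<^esub> h) \<in> ?C"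
        using subgroup.m_closed[OF C subgroup.m_inv_closed[OF C w(2)]] by blast
      moreover have "inv\<^bsub>free_group\<^esub> w \<otimes>\<^bsub>free_group\<^esub> (w \<otimes>\<^bsub>free_group\<^esub> h) = h"
        using w h F.inv_closed[of w] F.l_inv[of w] F.l_one[of h] F.m_assoc[of "inv\<^bsub>free_group\<^esub> w" w h]
        by (simp add: carrier_free_group)
      ultimately show ?thesis
        by simp
    qed
    then show False
      using cyclicI[OF s'(1)] noncyclic by blast
  qed
  then show thesis
    using that by blast
qed

text \<open>One element with a suitable first letter is joined to one with a suitable last letter.
  If they cancel at the junction, \<open>h2\<close> goes between them: it starts with no inverse of
  \<open>last h1\<close> and does not end with \<open>last h1\<close>, the inverse of
  \<open>hd h3\<close> in that case.\<close>

lemma obtain_between: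
  obtains h where "h \<in> H" "h \<noteq> []" "hd h \<noteq> b" "last h \<noteq> letter_inv c"
proof -
  obtain h1 where h1: "h1 \<in> H" "h1 \<noteq> []" "hd h1 \<noteq> b"
    by (rule obtain_return)
  obtain h3 where h3: "h3 \<in> H" "h3 \<noteq> []" "last h3 \<noteq> letter_inv c"
    by (rule obtain_return)
  obtain h2 where h2: "h2 \<in> H" "h2 \<noteq> []" "hd h2 \<noteq> letter_inv (last h1)"
    "last h2 \<noteq> letter_inv (letter_inv (last h1))"
    by (rule obtain_return)
  show thesis
  proof (cases "hd h3 = letter_inv (last h1)")
    case False
    then have "h1 @ h3 \<in> H"
      using h1 h3 by (auto intro: append_mem)
    then show ?thesis
      using that[of "h1 @ h3"] h1 h3 by simp
  next
    case True
    then have "h2 @ h3 \<in> H"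
      using h2 h3 by (auto intro: append_mem)
    then have "h1 @ h2 @ h3 \<in> H"
      using h1 h2 by (auto intro: append_mem)
    then show ?thesis
      using that[of "h1 @ h2 @ h3"] h1 h2 h3 by simp
  qed
qed

text \<open>The form in which ergodicity is used. A connecting word need only suit the last letter
  of \<open>u\<close> and the first letter of \<open>v\<close>, and there are finitely many pairs of
  letters.\<close>

lemma bounded_connection:
  obtains B where "\<And>u v. u \<in> H \<Longrightarrow> v \<in> H \<Longrightarrow> u \<noteq> [] \<Longrightarrow> v \<noteq> [] \<Longrightarrow>
    \<exists>h. length h \<le> B \<and> u @ h @ v \<in> H"
proof -
  define g where "g = (\<lambda>(b, c). SOME h. h \<in> H \<and> h \<noteq> [] \<and> hd h \<noteq> b \<and> last h \<noteq> letter_inv c)"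
  have g: "g (b, c) \<in> H \<and> g (b, c) \<noteq> [] \<and> hd (g (b, c)) \<noteq> b \<and> last (g (b, c)) \<noteq> letter_inv c"
    for b c
    unfolding g_def prod.case by (rule someI_ex) (metis obtain_between)
  show thesis
  proof (rule that)
    fix u v
    assume uv: "u \<in> H" "v \<in> H" "u \<noteq> []" "v \<noteq> []"
    let ?h = "g (letter_inv (last u), hd v)"
    have h: "?h \<in> H" "?h \<noteq> []" "hd ?h \<noteq> letter_inv (last u)" "last ?h \<noteq> letter_inv (hd v)"
      using g by blast+
    have "?h @ v \<in> H"
      using h uv letter_inv_eq_swap[of "last ?h" "hd v"]
      by (auto intro: append_mem)
    then have "u @ ?h @ v \<in> H"
      using h uv by (auto intro: append_mem)
    moreover have "length ?h \<le> Max (range (length \<circ> g))"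
      by (rule Max_ge) auto
    ultimately show "\<exists>h. length h \<le> Max (range (length \<circ> g)) \<and> u @ h @ v \<in> H"
      by blast
  qed
qed

text \<open>Two distinct words of equal length that can be concatenated freely inside
  \<open>H\<close>; they force exponential growth.\<close>

lemma obtain_two_loops:
  obtains x y where "x \<noteq> y" "length x = length y" "x \<noteq> []"
    "\<And>xs. set xs \<subseteq> {x, y} \<Longrightarrow> concat xs \<in> H"
proof -
  obtain s where s: "s \<in> H" "s \<noteq> []" "last s \<noteq> letter_inv (hd s)"
    by (rule obtain_cyclically_reduced)
  let ?t = "word_inv s"
  have t: "?t \<in> H" "hd ?t = letter_inv (last s)" "last ?t = letter_inv (hd s)"
    using s word_inv_mem by (auto simp: hd_word_inv last_word_inv)
  obtain h where h: "h \<in> H" "h \<noteq> []" "hd h \<noteq> hd s" "last h \<noteq> letter_inv (hd s)"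
    by (rule obtain_return)
  obtain k where k: "k \<in> H" "k \<noteq> []" "hd k \<noteq> letter_inv (last s)"
    "last k \<noteq> letter_inv (letter_inv (last s))"
    by (rule obtain_return)
  have red: "reduced s" "reduced h" "reduced k"
    using s h k by (auto simp: mem_iff)
  have ss: "s @ s \<in> H" "?t @ ?t \<in> H"
    using s t red by (auto intro: append_mem simp: letter_inv_eq_swap)
  have hs: "h @ s \<in> H" "h @ s @ s \<in> H"
    using s h red ss by (auto intro: append_mem simp: letter_inv_eq_swap)
  have ths: "?t @ h @ s \<in> H" "?t @ h @ s @ s \<in> H"
    using s h t red ss hs by (auto intro: append_mem simp: letter_inv_eq_swap)
  have tths: "?t @ ?t @ h @ s \<in> H"
    using s h t red ss ths by (auto intro: append_mem simp: letter_inv_eq_swap)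
  \<comment> \<open>Both words start with \<open>k\<close> and end with \<open>s\<close>, a junction
    without cancellation, and they have the same letters count because \<open>?t\<close> is as long
    as \<open>s\<close>. Equality would mean \<open>?t @ h = h @ s\<close>, which
    \<open>word_inv_conj_ne\<close> excludes.\<close>
  define x where "x = k @ ?t @ ?t @ h @ s"
  define y where "y = k @ ?t @ h @ s @ s"
  have xy: "x \<in> H" "y \<in> H"
    unfolding x_def y_def using k t s tths ths
    by (auto intro: append_mem simp: letter_inv_eq_swap)
  have "x \<noteq> y"
  proof
    assume "x = y"
    then have "(?t @ h) @ s = (h @ s) @ s"
      by (simp add: x_def y_def)
    then show False
      using word_inv_conj_ne[OF red(1) s(2)] by (simp only: append_same_eq)
  qed
  moreover have "concat xs \<in> H" if "set xs \<subseteq> {x, y}" for xs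
    using xy s k that by (intro concat_mem[of "{x, y}" "hd k" "last s"]) (auto simp: x_def y_def)
  moreover have "length x = length y" "x \<noteq> []"
    using s by (simp_all add: x_def y_def)
  ultimately show thesis
    using that by blast
qed

text \<open>Whether a prefix can replace \<open>p\<close> depends only on the vertex reached by
  \<open>p\<close> and on the first letter of \<open>u\<close>, a finite set of data for which one
  prefix each is fixed.\<close>

lemma bounded_prefix:
  assumes "finite (core_verts H)"
  obtains B where "\<And>p u q. p @ u @ q \<in> H \<Longrightarrow> u \<noteq> [] \<Longrightarrow> \<exists>p'. length p' \<le> B \<and> p' @ u @ q \<in> H"
proof -
  define D :: "('a coset \<times> 'a letter) set" where "D = core_verts H \<times> UNIV"
  define good where "good = (\<lambda>(v, y) p. reduced p \<and> path_end H p = v \<and> (p \<noteq> [] \<longrightarrow> y \<noteq> letter_inv (last p)))"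
  define f where "f d = (SOME p. good d p)" for d
  have "finite D"
    using assms by (simp add: D_def)
  show thesis
  proof (rule that)
    fix p u q assume H: "p @ u @ q \<in> H" "u \<noteq> []"
    let ?d = "(path_end H p, hd u)"
    have "good ?d p"
      using mem_reduced[OF H(1)] H(2) by (auto simp: good_def reduced_append)
    then have "good ?d (f ?d)"
      unfolding f_def by (rule someI)
    then have "f ?d @ u @ q \<in> H"
      using H unfolding mem_iff[of "p @ u @ q"] mem_iff[of "f ?d @ u @ q"]
      by (auto simp: good_def reduced_append path_end_append)
    moreover have "?d \<in> D"
      using core_vertsI[OF H(1)] by (simp add: D_def)
    then have "length (f ?d) \<le> Max ((\<lambda>d. length (f d)) ` D)"
      using \<open>finite D\<close> by (intro Max_ge) auto
    ultimately show "\<exists>p'. length p' \<le> Max ((\<lambda>d. length (f d)) ` D) \<and> p' @ u @ q \<in> H"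
      by blast
  qed
qed

text \<open>The bound on prefixes is applied a second time to the inverse word, which exchanges
  prefix and suffix.\<close>

lemma bounded_context:
  assumes "finite (core_verts H)"
  obtains B where "\<And>p u q. p @ u @ q \<in> H \<Longrightarrow> u \<noteq> [] \<Longrightarrow>
    \<exists>p' q'. length p' \<le> B \<and> length q' \<le> B \<and> p' @ u @ q' \<in> H"
proof -
  obtain B where B: "\<And>p u q. p @ u @ q \<in> H \<Longrightarrow> u \<noteq> [] \<Longrightarrow> \<exists>p'. length p' \<le> B \<and> p' @ u @ q \<in> H"
    using bounded_prefix[OF assms] by blast
  show thesis
  proof (rule that)
    fix p u q assume H: "p @ u @ q \<in> H" "u \<noteq> []"
    obtain p' where p': "length p' \<le> B" "p' @ u @ q \<in> H"
      using B[OF H] by blast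
    have "word_inv q @ word_inv u @ word_inv p' \<in> H"
      using word_inv_mem[OF p'(2)] by simp
    then obtain q' where q': "length q' \<le> B" "q' @ word_inv u @ word_inv p' \<in> H"
      using B H(2) by fastforce
    then have "p' @ u @ word_inv q' \<in> H"
      using word_inv_mem[OF q'(2)] by simp
    then show "\<exists>p' q'. length p' \<le> B \<and> length q' \<le> B \<and> p' @ u @ q' \<in> H"
      using p' q' length_word_inv by metis
  qed
qed

lemma cogrowth_gt_1: "1 < cogrowth H"
proof -
  obtain x y where xy: "x \<noteq> y" "length x = length y" "x \<noteq> []"
    and mem: "\<And>xs. set xs \<subseteq> {x, y} \<Longrightarrow> concat xs \<in> H"
    using obtain_two_loops by blast
  \<comment> \<open>With this \<open>s\<close> each loop has weight 3/4, so the two together weigh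
    3/2; any weight strictly between 1/2 and 1 would serve.\<close>
  define s where "s = root (length x) (3 / 4)"
  have s: "0 < s" "s < 1" "s ^ length x = 3 / 4"
    using xy(3) by (simp_all add: s_def)
  have "ereal (1 / s) \<le> cogrowth H"
  proof (rule cogrowth_ge_of_code[where F = "{x, y}" and wt = length and f = concat and c = 0])
    show "inj_on concat {xs. set xs \<subseteq> {x, y} \<and> length xs = k}" for k
      using xy by (intro concat_inj_prefix_code) auto
  qed (use xy s mem in \<open>auto simp: length_concat\<close>)
  moreover have "1 < ereal (1 / s)"
    using s by (simp add: one_ereal_def)
  ultimately show ?thesis
    by (rule less_le_trans[rotated])
qed

end

section \<open>The Whitehead automorphism\<close>

lemma inv_word: "reduced w \<Longrightarrow> inv\<^bsub>free_group\<^esub> w = word_inv w"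
proof (rule group.inv_equality[OF group_free_group])
  assume w: "reduced w"
  then show "word_inv w \<otimes>\<^bsub>free_group\<^esub> w = \<one>\<^bsub>free_group\<^esub>"
    using left_inverse_word[of "[]" w] reduce_reduced[OF w]
    by (simp add: mult_free_group one_free_group reduce_append word_inv_def) (simp add: reduce_def)
qed (simp_all add: carrier_free_group)

lemma mult_Nil [simp]:
  "reduced u \<Longrightarrow> u \<otimes>\<^bsub>free_group\<^esub> [] = u" "reduced u \<Longrightarrow> [] \<otimes>\<^bsub>free_group\<^esub> u = u"
  by (simp_all add: mult_free_group reduce_reduced)

lemma reduced_mult [simp]: "reduced (u \<otimes>\<^bsub>free_group\<^esub> v)"
  by (simp add: mult_free_group reduced_reduce)

lemma mult_assoc:
  "reduced u \<Longrightarrow> reduced v \<Longrightarrow> reduced w \<Longrightarrow>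
    u \<otimes>\<^bsub>free_group\<^esub> v \<otimes>\<^bsub>free_group\<^esub> w = u \<otimes>\<^bsub>free_group\<^esub> (v \<otimes>\<^bsub>free_group\<^esub> w)"
  using monoid.m_assoc[OF group.is_monoid[OF group_free_group], of u v w]
  by (simp add: carrier_free_group)

lemma length_mult_le: "length (u \<otimes>\<^bsub>free_group\<^esub> v) \<le> length u + length v"
  using length_reduce_le[of "u @ v"] by (simp add: mult_free_group)

lemma whitehead_aut_append:
  "whitehead_aut A a (u @ v) = whitehead_aut A a u \<otimes>\<^bsub>free_group\<^esub> whitehead_aut A a v"
  unfolding whitehead_aut_def
  by (rule group.word_eval_append[OF group_free_group whitehead_gen_closed])

lemma whitehead_aut_Nil [simp]: "whitehead_aut A a [] = []"
  by (simp add: whitehead_aut_def group.word_eval_Nil[OF group_free_group] one_free_group)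

lemma reduced_whitehead_aut [simp]: "reduced (whitehead_aut A a w)"
  using group.word_eval_closed[OF group_free_group whitehead_gen_closed]
  by (simp add: whitehead_aut_def carrier_free_group)

text \<open>Stated for letters of either sign, the cases of \<open>whitehead_gen\<close> merge into
  two independent rules: membership of \<open>y\<close> in \<open>A\<close> governs the left end,
  membership of its inverse the right end.\<close>

lemma whitehead_aut_letter:
  assumes "A \<subseteq> UNIV - {a, letter_inv a}"
  shows "whitehead_aut A a [y] =
    (if y = a \<or> y = letter_inv a then [y]
     else (if y \<in> A then [a] else []) @ [y] @ (if letter_inv y \<in> A then [letter_inv a] else []))"
proof -
  obtain x b where y: "y = (x, b)"
    by (cases y)
  have gen: "reduced (whitehead_gen A a x)"
    using whitehead_gen_closed[of A a] by (auto simp: carrier_free_group)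
  then have "whitehead_aut A a [y] = (if b then whitehead_gen A a x else word_inv (whitehead_gen A a x))"
    by (simp add: whitehead_aut_def y group.word_eval_Cons[OF group_free_group] one_free_group
        group.word_eval_Nil[OF group_free_group] inv_word)
  then show ?thesis
    using assms by (cases a; cases b) (auto simp: y whitehead_gen_def letter_inv_def)
qed

lemma mult_singleton_cancel [simp]:
  "[a] \<otimes>\<^bsub>free_group\<^esub> [letter_inv a] = []" "[letter_inv a] \<otimes>\<^bsub>free_group\<^esub> [a] = []"
  by (simp_all add: mult_free_group reduce_def)

section \<open>The deletion of letters along the collapsed edges\<close>

locale ascari_subgroup = noncyclic_subgroup +
  fixes A a
  assumes ascari: "ascari_pair H A a"
begin

abbreviation \<phi> :: "'a word \<Rightarrow> 'a word" where
  "\<phi> \<equiv> whitehead_aut A a"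

lemma A_subset: "A \<subseteq> UNIV - {a, letter_inv a}"
  using ascari by (simp add: ascari_pair_def)

text \<open>An infinite set has \<open>card\<close> 0, which no cardinality is strictly
  below.\<close>

lemma finite_core_verts: "finite (core_verts H)"
  using ascari card_ge_0_finite[of "core_verts H"] by (simp add: ascari_pair_def)

text \<open>Along a path of the core, \<open>\<phi>\<close> is conjugate, through these words, to the operation that
  deletes some of the letters \<open>a\<close> and \<open>a\<inverse>\<close>: the collapsed edges are those labelled \<open>a\<close> that
  leave a vertex with \<open>shift v = [a]\<close>.\<close>

definition shift :: "'a coset \<Rightarrow> 'a word" where
  "shift v = (if out_labels H v \<inter> A = {} then [] else [a])"

lemma reduced_shift [simp]: "reduced (shift v)"
  and length_shift_le: "length (shift v) \<le> 1"
  by (simp_all add: shift_def)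

lemma out_labels_shift:
  assumes "v \<in> core_verts H" "shift v \<noteq> []"
  shows "out_labels H v \<subseteq> A \<union> {a}"
  using assms ascari by (auto simp: ascari_pair_def exactly_one_def shift_def split: if_splits)

text \<open>By the trichotomy, the labels other than \<open>a\<close> at a vertex are all in
  \<open>A\<close> or all outside it, so any one of them determines the shift.\<close>

lemma shift_eq:
  assumes "v \<in> core_verts H" "y \<in> out_labels H v" "y \<noteq> a"
  shows "shift v = (if y \<in> A then [a] else [])"
proof (cases "shift v = []")
  case True
  then show ?thesis
    using assms(2) by (auto simp: shift_def split: if_splits)
next
  case False
  then have "y \<in> A"
    using out_labels_shift[OF assms(1)] assms(2,3) by blast
  then show ?thesis
    using False by (simp add: shift_def split: if_splits)
qed

text \<open>For \<open>y\<close> other than \<open>a\<close> and its inverse, the shift at the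
  terminus cancels the letter that \<open>\<phi>\<close> puts behind \<open>y\<close>, and the
  letter put in front is the shift at the origin. An edge labelled \<open>a\<close> ends at a vertex
  with label \<open>letter_inv a\<close>, outside \<open>A\<close>, so the shift there is empty and
  a shift \<open>[a]\<close> at the origin absorbs the letter; the inverse direction is
  symmetric.\<close>

lemma \<phi>_edge:
  assumes "p @ [y] @ q \<in> H"
  shows "\<phi> [y] \<otimes>\<^bsub>free_group\<^esub> shift (path_end H (p @ [y])) =
    shift (path_end H p) \<otimes>\<^bsub>free_group\<^esub>
      (if (y = a \<and> shift (path_end H p) = [a]) \<or>
          (y = letter_inv a \<and> shift (path_end H (p @ [y])) = [a]) then [] else [y])"
proof -
  let ?v = "path_end H p" and ?w = "path_end H (p @ [y])"
  have core: "?v \<in> core_verts H" "?w \<in> core_verts H"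
    using core_vertsI[of p "[y] @ q"] core_vertsI[of "p @ [y]" q] assms by simp_all
  have labels: "y \<in> out_labels H ?v" "letter_inv y \<in> out_labels H ?w"
    by (rule out_labelsI[OF assms] out_labels_inverseI[OF assms])+
  have shift_v: "shift ?v = (if y \<in> A then [a] else [])" if "y \<noteq> a"
    using that labels by (intro shift_eq[OF core(1)])
  have shift_w: "shift ?w = (if letter_inv y \<in> A then [a] else [])" if "letter_inv y \<noteq> a"
    using that labels by (intro shift_eq[OF core(2)])
  have A: "a \<notin> A" "letter_inv a \<notin> A"
    using A_subset by auto
  consider "y = a" | "y = letter_inv a" | "y \<noteq> a" "y \<noteq> letter_inv a"
    by blast
  then show ?thesis
  proof cases
    case 1
    then have "shift ?w = []"
      using shift_w A by simp
    then show ?thesis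
      using 1 by (simp add: whitehead_aut_letter[OF A_subset] shift_def)
  next
    case 2
    then have "shift ?v = []"
      using shift_v A by simp
    then show ?thesis
      using 2 by (simp add: whitehead_aut_letter[OF A_subset] shift_def)
  next
    case 3
    then have "letter_inv y \<noteq> a"
      by auto
    then show ?thesis
      using 3 shift_v shift_w
      by (simp add: whitehead_aut_letter[OF A_subset] mult_free_group reduce_def)
  qed
qed

text \<open>Applying \<open>\<phi>_edge\<close> letter by letter makes the shifts at inner vertices
  telescope. The last clause covers the situation without collapsed edges, which
  \<open>collapsed_edge_exists\<close> refutes.\<close>

lemma \<phi>_path:
  assumes "p @ u @ q \<in> H"
  shows "\<exists>z. reduced z \<and> length z \<le> length u \<and>
    \<phi> u \<otimes>\<^bsub>free_group\<^esub> shift (path_end H (p @ u)) = shift (path_end H p) \<otimes>\<^bsub>free_group\<^esub> z \<and>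
    ((\<forall>v\<in>core_verts H. a \<in> out_labels H v \<longrightarrow> shift v = []) \<longrightarrow> z = u)"
  using assms
proof (induction u arbitrary: p)
  case Nil
  then show ?case
    by (intro exI[of _ "[]"]) simp
next
  case (Cons y u)
  let ?v = "path_end H p" and ?w = "path_end H (p @ [y])" and ?e = "path_end H (p @ y # u)"
  have "(p @ [y]) @ u @ q \<in> H" and pyq: "p @ [y] @ (u @ q) \<in> H"
    using Cons.prems by simp_all
  then obtain z where z: "reduced z" "length z \<le> length u"
    "\<phi> u \<otimes>\<^bsub>free_group\<^esub> shift ?e = shift ?w \<otimes>\<^bsub>free_group\<^esub> z"
    "(\<forall>v\<in>core_verts H. a \<in> out_labels H v \<longrightarrow> shift v = []) \<longrightarrow> z = u"
    using Cons.IH[of "p @ [y]"] by auto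
  define x where "x = (if (y = a \<and> shift ?v = [a]) \<or> (y = letter_inv a \<and> shift ?w = [a])
    then [] else [y])"
  have edge: "\<phi> [y] \<otimes>\<^bsub>free_group\<^esub> shift ?w = shift ?v \<otimes>\<^bsub>free_group\<^esub> x"
    unfolding x_def by (rule \<phi>_edge[OF pyq])
  have x: "reduced x" "length x \<le> 1"
    by (simp_all add: x_def)
  have "\<phi> (y # u) \<otimes>\<^bsub>free_group\<^esub> shift ?e = \<phi> [y] \<otimes>\<^bsub>free_group\<^esub> (shift ?w \<otimes>\<^bsub>free_group\<^esub> z)"
    using whitehead_aut_append[of A a "[y]" u] z by (simp add: mult_assoc)
  also have "\<dots> = shift ?v \<otimes>\<^bsub>free_group\<^esub> (x \<otimes>\<^bsub>free_group\<^esub> z)"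
    using x z edge by (simp flip: mult_assoc)
  finally have "\<phi> (y # u) \<otimes>\<^bsub>free_group\<^esub> shift ?e = shift ?v \<otimes>\<^bsub>free_group\<^esub> (x \<otimes>\<^bsub>free_group\<^esub> z)" .
  moreover have "length (x \<otimes>\<^bsub>free_group\<^esub> z) \<le> length (y # u)"
    using length_mult_le[of x z] x z by simp
  moreover have "x \<otimes>\<^bsub>free_group\<^esub> z = y # u"
    if no: "\<forall>v\<in>core_verts H. a \<in> out_labels H v \<longrightarrow> shift v = []"
  proof -
    have "?v \<in> core_verts H" "?w \<in> core_verts H"
      using core_vertsI[of p "[y] @ (u @ q)"] core_vertsI[of "p @ [y]" "u @ q"] pyq by simp_all
    moreover have "y \<in> out_labels H ?v" "letter_inv y \<in> out_labels H ?w"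
      by (rule out_labelsI[OF pyq] out_labels_inverseI[OF pyq])+
    ultimately have "x = [y]"
      using no by (auto simp: x_def)
    moreover have "reduced ([y] @ u)"
      using mem_reduced[OF pyq] reduced_append[of p "[y] @ u @ q"] reduced_append[of "[y] @ u" q]
      by simp
    ultimately show ?thesis
      using z(4) no mult_reduced[of "[y]" u] by simp
  qed
  ultimately show ?case
    by (intro exI[of _ "x \<otimes>\<^bsub>free_group\<^esub> z"]) simp
qed

text \<open>Left and right multiplication commute, so left translation by \<open>a\<close> carries
  paths among the cosets of a subgroup to paths among those of its conjugate by
  \<open>a\<close>.\<close>

lemma path_end_l_coset:
  assumes "v \<subseteq> carrier free_group"
  shows "path_end ([a] <#\<^bsub>free_group\<^esub> v) w = [a] <#\<^bsub>free_group\<^esub> path_end v w"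
  using assms
proof (induction w arbitrary: v)
  case (Cons y w)
  interpret F: group "free_group :: 'a word monoid"
    by (rule group_free_group)
  have "coset_step ([a] <#\<^bsub>free_group\<^esub> v) y = [a] <#\<^bsub>free_group\<^esub> coset_step v y"
    using Cons.prems by (simp add: coset_step_def F.coset_assoc carrier_free_group)
  then show ?case
    using Cons by (simp add: path_end_Cons coset_step_closed)
qed simp

lemma l_coset_inj: "inj_on (l_coset free_group [a]) {v. v \<subseteq> carrier free_group}"
proof (rule inj_on_inverseI)
  interpret F: group "free_group :: 'a word monoid"
    by (rule group_free_group)
  fix v :: "'a coset"
  assume "v \<in> {v. v \<subseteq> carrier free_group}"
  then show "[letter_inv a] <#\<^bsub>free_group\<^esub> ([a] <#\<^bsub>free_group\<^esub> v) = v"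
    using F.lcos_m_assoc[of v "[letter_inv a]" "[a]"] F.lcos_mult_one[of v]
    by (simp add: carrier_free_group one_free_group)
qed

text \<open>Without collapsed edges, \<open>\<phi>(H)\<close> would be \<open>H\<close> or \<open>a H a\<inverse>\<close>, the core of the latter
  being that of \<open>H\<close> with an edge attached to the root.\<close>

lemma collapsed_edge_exists:
  obtains v where "v \<in> core_verts H" "a \<in> out_labels H v" "shift v = [a]"
proof -
  interpret F: group "free_group :: 'a word monoid"
    by (rule group_free_group)
  have "\<exists>v\<in>core_verts H. a \<in> out_labels H v \<and> shift v = [a]"
  proof (rule ccontr)
    assume "\<not> ?thesis"
    then have no: "\<forall>v\<in>core_verts H. a \<in> out_labels H v \<longrightarrow> shift v = []"
      unfolding shift_def by metis
    have \<phi>_conj: "\<phi> w \<otimes>\<^bsub>free_group\<^esub> shift H = shift H \<otimes>\<^bsub>free_group\<^esub> w" if "w \<in> H" for w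
      using \<phi>_path[of "[]" w "[]"] that no mem_iff[of w] by auto
    show False
    proof (cases "shift H = []")
      case True
      then have "\<phi> ` H = H"
        using \<phi>_conj by (force simp: mem_reduced image_iff)
      then show False
        using ascari by (simp add: ascari_pair_def)
    next
      case False
      then have shift_H: "shift H = [a]"
        by (auto simp: shift_def)
      have \<phi>_shift: "\<phi> w = [a] \<otimes>\<^bsub>free_group\<^esub> (w \<otimes>\<^bsub>free_group\<^esub> [letter_inv a])"
        if "w \<in> H" for w
      proof -
        have "\<phi> w = (\<phi> w \<otimes>\<^bsub>free_group\<^esub> [a]) \<otimes>\<^bsub>free_group\<^esub> [letter_inv a]"
          by (simp add: mult_assoc)
        also have "\<dots> = ([a] \<otimes>\<^bsub>free_group\<^esub> w) \<otimes>\<^bsub>free_group\<^esub> [letter_inv a]"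
          using \<phi>_conj[OF that] shift_H by simp
        also have "\<dots> = [a] \<otimes>\<^bsub>free_group\<^esub> (w \<otimes>\<^bsub>free_group\<^esub> [letter_inv a])"
          using that by (simp add: mult_assoc mem_reduced)
        finally show ?thesis .
      qed
      obtain s where s: "s \<in> H" "s \<noteq> []"
        by (rule obtain_cyclically_reduced)
      have H_core: "H \<in> core_verts H"
        using core_vertsI[of "[]" s] s by simp
      \<comment> \<open>The shift at the root is \<open>[a]\<close>, so the label \<open>a\<close>
        there would belong to a collapsed edge.\<close>
      then have labels_H: "out_labels H H \<subseteq> A"
        using out_labels_shift[OF H_core False] no False by auto
      have \<phi>_eq: "\<phi> w = [a] @ w @ [letter_inv a]" and red: "reduced ([a] @ w @ [letter_inv a])"
        if w: "w \<in> H" "w \<noteq> []" for w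
      proof -
        have "[] @ [hd w] @ tl w \<in> H" "butlast w @ [last w] @ [] \<in> H"
          using w by simp_all
        then have "hd w \<in> out_labels H H" "letter_inv (last w) \<in> out_labels H H"
          using out_labelsI[of "[]" "hd w" "tl w"] out_labels_inverseI[of "butlast w" "last w" "[]"] w mem_iff[of w]
          by auto
        then have "hd w \<in> A" "letter_inv (last w) \<in> A"
          using labels_H by auto
        then have "hd w \<noteq> letter_inv a" "last w \<noteq> a"
          using A_subset by auto
        then show red: "reduced ([a] @ w @ [letter_inv a])"
          using w mem_reduced[of w] by (auto simp: reduced_append reduced_Cons)
        have "reduced (w @ [letter_inv a])"
          using red reduced_append[of "[a]" "w @ [letter_inv a]"] by simp
        then show "\<phi> w = [a] @ w @ [letter_inv a]"
          using red \<phi>_shift[OF w(1)] mult_reduced[of "[a]" "w @ [letter_inv a]"]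
          by (simp add: mult_reduced)
      qed
      define K where "K = \<phi> ` H"
      have "subgroup K free_group"
        unfolding K_def using subgroup
        by (intro group_hom.subgroup_img_is_subgroup)
          (auto simp: group_hom_def group_hom_axioms_def group_free_group whitehead_aut_hom)
      then interpret K: free_subgroup K
        by (rule free_subgroup.intro)
      have \<phi>_words: "a # w @ [letter_inv a] \<in> K" if "w \<in> H" "w \<noteq> []" for w
        using \<phi>_eq[OF that] that by (force simp: K_def)
      \<comment> \<open>\<open>K\<close> is the conjugate of \<open>H\<close> by \<open>a\<close>;
        one step \<open>a\<close> from its root leads to the translate of the root of
        \<open>H\<close>.\<close>
      have step: "path_end K [a] = [a] <#\<^bsub>free_group\<^esub> H"
      proof -
        have "K = [a] <#\<^bsub>free_group\<^esub> (H #>\<^bsub>free_group\<^esub> [letter_inv a])"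
          using \<phi>_shift by (auto simp: K_def l_coset_def r_coset_def image_iff)
        then have "path_end K [a] =
            [a] <#\<^bsub>free_group\<^esub> coset_step (coset_step H (letter_inv a)) (letter_inv (letter_inv a))"
          using path_end_l_coset[of "coset_step H (letter_inv a)" "[a]"]
          by (simp add: coset_step_def[of H, symmetric] coset_step_closed closed path_end_Cons)
        then show ?thesis
          by (simp add: coset_step_inverse closed del: letter_inv_invol)
      qed
      have path_K: "path_end K (a # u) = [a] <#\<^bsub>free_group\<^esub> path_end H u" for u
        using step path_end_append[of K "[a]" u] by (simp add: path_end_l_coset closed)
      \<comment> \<open>This inclusion supplies finiteness of the core of \<open>K\<close>, so that
        the injection of the core of \<open>H\<close> into it compares cardinalities.\<close>
      have "core_verts K \<subseteq> insert K (l_coset free_group [a] ` core_verts H)"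
      proof
        fix v assume "v \<in> core_verts K"
        then obtain i w where v: "v = path_end K (take i w)" and w: "w \<in> K"
          by (auto simp: core_verts_def K.reduced_closed_paths_eq)
        obtain h where h: "h \<in> H" "w = \<phi> h"
          using w by (auto simp: K_def)
        show "v \<in> insert K (l_coset free_group [a] ` core_verts H)"
        proof (cases "h = [] \<or> i = 0 \<or> i \<ge> length w")
          case True
          then have "take i w = [] \<or> take i w = w"
            using h(2) by auto
          moreover have "path_end K w = K"
            using w K.mem_iff by blast
          ultimately have "v = K"
            unfolding v by (elim disjE) (simp_all only: path_end_Nil)
          then show ?thesis
            by simp
        next
          case False
          then obtain j where j: "i = Suc j" "j \<le> length h"
            using h \<phi>_eq by (cases i) auto
          then have "v = [a] <#\<^bsub>free_group\<^esub> path_end H (take j h)"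
            using v h False \<phi>_eq path_K by simp
          moreover have "path_end H (take j h) \<in> core_verts H"
            using core_vertsI[of "take j h" "drop j h"] h by simp
          ultimately show ?thesis
            by blast
        qed
      qed
      then have finite_K: "finite (core_verts K)"
        by (rule finite_subset) (simp add: finite_core_verts)
      have "l_coset free_group [a] ` core_verts H \<subseteq> core_verts K"
      proof (rule image_subsetI)
        fix v assume "v \<in> core_verts H"
        then obtain i w where v: "v = path_end H (take i w)" and w: "w \<in> H"
          by (auto simp: core_verts_def reduced_closed_paths_eq)
        \<comment> \<open>The root may come from the empty word, on which
          \<open>\<phi>_words\<close> is silent; the nonempty \<open>s\<close> then replaces
          it.\<close>
        obtain u u' where u: "v = path_end H u" "u @ u' \<in> H" "u @ u' \<noteq> []"
        proof (cases "w = []")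
          case True
          then show thesis
            using that[of "[]" s] v s by simp
        next
          case False
          then show thesis
            using that[of "take i w" "drop i w"] v w by simp
        qed
        have "(a # u) @ (u' @ [letter_inv a]) \<in> K"
          using \<phi>_words[OF u(2,3)] by simp
        then show "[a] <#\<^bsub>free_group\<^esub> v \<in> core_verts K"
          using K.core_vertsI[of "a # u"] path_K u by simp
      qed
      moreover have "inj_on (l_coset free_group [a]) (core_verts H)"
        by (rule inj_on_subset[OF l_coset_inj])
          (auto simp: core_verts_def intro: path_end_closed[OF closed, THEN subsetD])
      ultimately have "card (core_verts H) \<le> card (core_verts K)"
        using finite_K by (intro card_inj_on_le)
      then show False
        using ascari by (simp add: ascari_pair_def K_def)
    qed
  qed
  then show thesis
    using that by blast
qed

lemma cogrowth_less: "cogrowth H < cogrowth (\<phi> ` H)"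
proof -
  obtain \<alpha> where \<alpha>: "cogrowth H = ereal \<alpha>" "1 < \<alpha>"
    using cogrowth_gt_1 cogrowth_finite[of H] by (cases "cogrowth H") (auto simp: one_ereal_def)
  obtain p0 q0 where p0: "p0 @ [a] @ q0 \<in> H" "shift (path_end H p0) = [a]"
    using collapsed_edge_exists out_labelsE by metis
  define v where "v = path_end H (p0 @ [a])"
  have v_closed: "v \<subseteq> carrier free_group"
    unfolding v_def by (rule path_end_closed[OF closed])
  \<comment> \<open>Here \<open>v\<close> is the terminus of a collapsed edge. A closed path at
    \<open>v\<close> whose last letter is \<open>a\<close> must end by traversing that edge, since
    edges with a given label and terminus are unique. Reducedness of \<open>a # u\<close> allows
    such paths to be composed.\<close>
  define U where "U = {u. reduced (a # u) \<and> path_end v u = v \<and> (u \<noteq> [] \<longrightarrow> last u = a)}"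
  have U_mem: "p0 @ [a] @ u @ q0 \<in> H" if "u \<in> U" for u
  proof -
    have u: "reduced (a # u)" "path_end v u = v" "u \<noteq> [] \<longrightarrow> last u = a"
      using that by (simp_all add: U_def)
    have q0: "reduced (p0 @ [a] @ q0)" "path_end v q0 = H"
      using p0(1) unfolding mem_iff by (simp_all add: v_def path_end_append path_end_Cons)
    have "path_end H (p0 @ [a] @ u @ q0) = path_end (path_end v u) q0"
      by (simp add: v_def path_end_append path_end_Cons)
    then have "path_end H (p0 @ [a] @ u @ q0) = H"
      by (simp only: u(2) q0(2))
    moreover have "reduced (p0 @ [a] @ u @ q0)"
      using q0(1) u(1,3) by (cases "u = []") (auto simp: reduced_append reduced_Cons)
    ultimately show ?thesis
      by (simp only: mem_iff simp_thms)
  qed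
  have memU: "u \<in> U" if u: "p0 @ [a] @ u @ q0 \<in> H" "u \<noteq> [] \<longrightarrow> last u = a" for u
  proof -
    have "path_end H (p0 @ [a] @ u) = path_end H (p0 @ [a])"
      using path_end_rev[of "p0 @ [a] @ u" q0] path_end_rev[of "p0 @ [a]" q0] u(1) p0(1) by simp
    moreover have "reduced (a # u)"
      using mem_reduced[OF u(1)] reduced_append[of p0 "[a] @ u @ q0"] reduced_append[of "[a] @ u" q0]
      by simp
    ultimately show ?thesis
      using u(2) by (simp add: U_def v_def path_end_append path_end_Cons)
  qed
  have U_append: "u @ w \<in> U" if "u \<in> U" "w \<in> U" for u w
    using that unfolding U_def
    by (cases "u = []"; cases "w = []") (auto simp: path_end_append reduced_append reduced_Cons)
  have unitary: "\<forall>u\<in>U. \<forall>w. u @ w \<in> U \<longrightarrow> w \<in> U"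
  proof (intro ballI allI impI)
    fix u w assume "u \<in> U" "u @ w \<in> U"
    then show "w \<in> U"
      unfolding U_def
      by (cases "u = []"; cases "w = []") (auto simp: path_end_append reduced_append reduced_Cons)
  qed
  define L where "L = {u. \<exists>p q. p @ u @ q \<in> H}"
  have L_factorial: "u \<in> L \<and> w \<in> L" if uw: "u @ w \<in> L" for u w
  proof -
    obtain p q where "p @ (u @ w) @ q \<in> H"
      using uw by (auto simp: L_def)
    then have "p @ u @ (w @ q) \<in> H" "(p @ u) @ w @ q \<in> H"
      by simp_all
    then show ?thesis
      unfolding L_def by blast
  qed
  have "w \<in> L" if "w \<in> H" for w
  proof -
    have "[] @ w @ [] \<in> H"
      using that by simp
    then show ?thesis
      unfolding L_def by blast
  qed
  then have "H \<subseteq> L"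
    by blast
  then have growth: "\<alpha> ^ n \<le> real (card {w \<in> L. length w = n})" for n
    by (rule factorial_language_growth[OF _ _ \<alpha>, rotated]) (rule L_factorial)
  obtain B1 where B1: "\<And>u w. u \<in> H \<Longrightarrow> w \<in> H \<Longrightarrow> u \<noteq> [] \<Longrightarrow> w \<noteq> [] \<Longrightarrow>
      \<exists>h. length h \<le> B1 \<and> u @ h @ w \<in> H"
    using bounded_connection by blast
  obtain B2 where B2: "\<And>p u q. p @ u @ q \<in> H \<Longrightarrow> u \<noteq> [] \<Longrightarrow>
      \<exists>p' q'. length p' \<le> B2 \<and> length q' \<le> B2 \<and> p' @ u @ q' \<in> H"
    using bounded_context[OF finite_core_verts] by blast
  \<comment> \<open>An occurrence of \<open>w\<close> is completed to a closed path, with a passage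
    through the collapsed edge before and after it. Cutting behind these two passages leaves
    \<open>q0 @ h1 @ p\<close> before \<open>w\<close> and \<open>q @ h2 @ p0 @ [a]\<close> after
    it.\<close>
  define R where "R = length q0 + B1 + B2 + length p0 + 1"
  have ext: "\<exists>x y. length x \<le> R \<and> length y \<le> R \<and> x @ w @ y \<in> U" if w: "w \<in> L" "w \<noteq> []" for w
  proof -
    obtain p q where pq: "length p \<le> B2" "length q \<le> B2" "p @ w @ q \<in> H"
      using B2 w unfolding L_def by blast
    obtain h1 where h1: "length h1 \<le> B1" "(p0 @ [a] @ q0) @ h1 @ (p @ w @ q) \<in> H"
      using B1[OF p0(1) pq(3)] w(2) by auto
    obtain h2 where h2: "length h2 \<le> B1"
      "((p0 @ [a] @ q0) @ h1 @ (p @ w @ q)) @ h2 @ (p0 @ [a] @ q0) \<in> H"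
      using B1[OF h1(2) p0(1)] by auto
    have "(q0 @ h1 @ p) @ w @ (q @ h2 @ p0 @ [a]) \<in> U"
      using h2(2) by (intro memU) simp_all
    moreover have "length (q0 @ h1 @ p) \<le> R" "length (q @ h2 @ p0 @ [a]) \<le> R"
      using pq h1 h2 by (simp_all add: R_def)
    ultimately show ?thesis
      by blast
  qed
  obtain F s where F: "finite F" "F \<subseteq> irreducibles U" "0 < s" "s < 1 / \<alpha>"
    "1 < (\<Sum>r\<in>F. s ^ (length r - 1))"
    using irreducibles_shortened_sum[OF unitary, of "1 / \<alpha>"]
      unbounded_sum_of_extensions[OF \<alpha>(2) growth ext] \<alpha>(2) by auto
  have concat_U: "concat xs \<in> U" if "set xs \<subseteq> F" for xs
    using that
  proof (induction xs)
    case (Cons r xs)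
    then show ?case
      using F(2) by (auto simp: irreducibles_def intro: U_append)
  qed (simp add: U_def)
  \<comment> \<open>The last letter of \<open>r\<close> is read along the collapsed edge, where it
    is absorbed by the shift \<open>[a]\<close> at the origin; the other letters obey the length
    bound of \<open>\<phi>_path\<close>.\<close>
  have shortened: "\<exists>z. reduced z \<and> length z \<le> length r - 1 \<and>
      \<phi> r \<otimes>\<^bsub>free_group\<^esub> shift v = shift v \<otimes>\<^bsub>free_group\<^esub> z" if r: "r \<in> U" "r \<noteq> []" for r
  proof -
    have "last r = a"
      using r by (simp add: U_def)
    then obtain r' where r': "r = r' @ [a]"
      using append_butlast_last_id[OF r(2)] by metis
    have path: "(p0 @ [a]) @ r' @ ([a] @ q0) \<in> H"
      using U_mem[OF r(1)] r' by simp
    have "path_end H (p0 @ [a] @ r') = path_end H p0"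
      using path_end_rev[of "p0 @ [a] @ r'" "[a] @ q0"] path_end_rev[of p0 "[a] @ q0"] path p0(1)
      by simp
    then have shift: "shift (path_end H ((p0 @ [a]) @ r')) = [a]"
      using p0(2) by simp
    obtain z where z: "reduced z" "length z \<le> length r'"
      "\<phi> r' \<otimes>\<^bsub>free_group\<^esub> [a] = shift v \<otimes>\<^bsub>free_group\<^esub> z"
      using \<phi>_path[OF path] unfolding shift v_def by blast
    have "\<phi> [a] \<otimes>\<^bsub>free_group\<^esub> shift v = [a]"
      using \<phi>_edge[OF p0(1)] p0(2) by (simp add: v_def)
    then have "\<phi> r \<otimes>\<^bsub>free_group\<^esub> shift v = shift v \<otimes>\<^bsub>free_group\<^esub> z"
      using z(3) by (simp add: r' whitehead_aut_append mult_assoc)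
    then show ?thesis
      using z r' by auto
  qed
  have shortened_concat: "\<exists>z. reduced z \<and> length z \<le> (\<Sum>r\<leftarrow>xs. length r - 1) \<and>
      \<phi> (concat xs) \<otimes>\<^bsub>free_group\<^esub> shift v = shift v \<otimes>\<^bsub>free_group\<^esub> z" if "set xs \<subseteq> F" for xs
    using that
  proof (induction xs)
    case Nil
    then show ?case
      by (intro exI[of _ "[]"]) simp
  next
    case (Cons r xs)
    then obtain z where z: "reduced z" "length z \<le> (\<Sum>r\<leftarrow>xs. length r - 1)"
      "\<phi> (concat xs) \<otimes>\<^bsub>free_group\<^esub> shift v = shift v \<otimes>\<^bsub>free_group\<^esub> z"
      by auto
    have "r \<in> U" "r \<noteq> []"
      using Cons.prems F(2) by (auto simp: irreducibles_def)
    then obtain x where x: "reduced x" "length x \<le> length r - 1"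
      "\<phi> r \<otimes>\<^bsub>free_group\<^esub> shift v = shift v \<otimes>\<^bsub>free_group\<^esub> x"
      using shortened by blast
    have "\<phi> (concat (r # xs)) \<otimes>\<^bsub>free_group\<^esub> shift v = \<phi> r \<otimes>\<^bsub>free_group\<^esub> (shift v \<otimes>\<^bsub>free_group\<^esub> z)"
      using z by (simp add: whitehead_aut_append mult_assoc)
    also have "\<dots> = shift v \<otimes>\<^bsub>free_group\<^esub> (x \<otimes>\<^bsub>free_group\<^esub> z)"
      using x z by (simp flip: mult_assoc)
    finally show ?case
      using length_mult_le[of x z] x z by (intro exI[of _ "x \<otimes>\<^bsub>free_group\<^esub> z"]) simp
  qed
  \<comment> \<open>The code words are closed up by \<open>p0 @ [a]\<close> and \<open>q0\<close> to
    land in \<open>H\<close> before \<open>\<phi>\<close> is applied. The constant \<open>c\<close>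
    counts the images of these two ends and one letter for each of the two shifts that conjugate the
    middle part. Injectivity combines that of \<open>\<phi>\<close> with the prefix code.\<close>
  have "ereal (1 / s) \<le> cogrowth (\<phi> ` H)"
  proof (rule cogrowth_ge_of_code[where F = F and wt = "\<lambda>r. length r - 1"
        and f = "\<lambda>xs. \<phi> (p0 @ [a] @ concat xs @ q0)"
        and c = "length (\<phi> (p0 @ [a])) + length (\<phi> q0) + 2"])
    have "1 / \<alpha> < 1"
      using \<alpha>(2) by simp
    then show "s < 1"
      using F(4) by linarith
    show "inj_on (\<lambda>xs. \<phi> (p0 @ [a] @ concat xs @ q0)) {xs. set xs \<subseteq> F \<and> length xs = k}" for k
    proof (rule inj_onI)
      fix xs ys
      assume xs: "xs \<in> {xs. set xs \<subseteq> F \<and> length xs = k}" and ys: "ys \<in> {xs. set xs \<subseteq> F \<and> length xs = k}"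
        and eq: "\<phi> (p0 @ [a] @ concat xs @ q0) = \<phi> (p0 @ [a] @ concat ys @ q0)"
      have "p0 @ [a] @ concat xs @ q0 \<in> carrier free_group" "p0 @ [a] @ concat ys @ q0 \<in> carrier free_group"
        using U_mem[OF concat_U] xs ys closed by blast+
      then have "p0 @ [a] @ concat xs @ q0 = p0 @ [a] @ concat ys @ q0"
        using whitehead_aut_inverse[OF _ A_subset] eq by metis
      then have "concat xs = concat ys"
        by simp
      moreover have "inj_on concat {xs. set xs \<subseteq> F \<and> length xs = k}"
        by (rule concat_inj_prefix_code) (use F(2) irreducibles_prefix_code[OF unitary] in blast)
      ultimately show "xs = ys"
        using xs ys by (simp add: inj_on_def)
    qed
    fix xs assume xs: "set xs \<subseteq> F"
    show "\<phi> (p0 @ [a] @ concat xs @ q0) \<in> \<phi> ` H"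
      by (rule imageI[OF U_mem[OF concat_U[OF xs]]])
    obtain z where z: "reduced z" "length z \<le> (\<Sum>r\<leftarrow>xs. length r - 1)"
      "\<phi> (concat xs) \<otimes>\<^bsub>free_group\<^esub> shift v = shift v \<otimes>\<^bsub>free_group\<^esub> z"
      using shortened_concat[OF xs] by blast
    have "shift v \<otimes>\<^bsub>free_group\<^esub> word_inv (shift v) = []"
      by (simp add: shift_def)
    then have "\<phi> (concat xs) = (\<phi> (concat xs) \<otimes>\<^bsub>free_group\<^esub> shift v) \<otimes>\<^bsub>free_group\<^esub> word_inv (shift v)"
      by (simp add: mult_assoc)
    then have "length (\<phi> (concat xs)) \<le> length z + 2"
      using length_mult_le[of "shift v \<otimes>\<^bsub>free_group\<^esub> z" "word_inv (shift v)"]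
        length_mult_le[of "shift v" z] length_shift_le[of v] z(3) by simp
    moreover have "\<phi> (p0 @ [a] @ concat xs @ q0) =
        \<phi> (p0 @ [a]) \<otimes>\<^bsub>free_group\<^esub> (\<phi> (concat xs) \<otimes>\<^bsub>free_group\<^esub> \<phi> q0)"
      using whitehead_aut_append[of A a "p0 @ [a]" "concat xs @ q0"] by (simp add: whitehead_aut_append)
    ultimately show "length (\<phi> (p0 @ [a] @ concat xs @ q0)) \<le>
        length (\<phi> (p0 @ [a])) + length (\<phi> q0) + 2 + (\<Sum>r\<leftarrow>xs. length r - 1)"
      using length_mult_le[of "\<phi> (p0 @ [a])" "\<phi> (concat xs) \<otimes>\<^bsub>free_group\<^esub> \<phi> q0"]
        length_mult_le[of "\<phi> (concat xs)" "\<phi> q0"] z(2) by simp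
  qed (use F in auto)
  moreover have "\<alpha> < 1 / s"
    using F(3,4) \<alpha>(2) by (simp add: field_simps)
  ultimately show ?thesis
    using \<alpha>(1) by (metis less_ereal.simps(1) less_le_trans)
qed

end

theorem corollary4p4:
  fixes H :: "('a :: finite) word set"
    and A :: "'a letter set"
    and a :: "'a letter"
  assumes rank: "CARD('a) > 2"
    and subgroup: "subgroup H free_group"
    and fin_gen: "finitely_generated free_group H"
    and cyc_red: "\<exists>S. (\<forall>w\<in>S. cyclically_reduced w) \<and> H = generate free_group S"
    and nontrivial: "\<not> trivial_group (subgroup_generated free_group H)"
    and noncyclic: "\<not> cyclic_group (subgroup_generated free_group H)"
    and factor: "free_factor free_group H"
    and cut: "\<exists>b. cut_vertex (whitehead_graph H) b"
    and ascari: "ascari_pair H A a"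
  shows "cogrowth H < cogrowth (whitehead_aut A a ` H)"
proof -
  interpret ascari_subgroup H A a
    using subgroup cyc_red noncyclic ascari
    by (intro ascari_subgroup.intro noncyclic_subgroup.intro free_subgroup.intro
        noncyclic_subgroup_axioms.intro ascari_subgroup_axioms.intro)
  show ?thesis
    by (rule cogrowth_less)
qed

end
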